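(* Let $b>0$, $0<\beta<2$, $0<\alpha\le\frac d2$, and let $x_1,\dots,x_n\in\mathbb{R}^d$ span $\mathbb{R}^d$ and satisfy $(d-2\alpha)\,|\{i:x_i\in L\}|<n\,d_L$ for every subspace $L\subset\mathbb{R}^d$ of dimension $1\le d_L<d$. Let $h(t)=(\frac d2-\alpha)t^{-1}+\frac{\beta}{b^\beta}t^{\beta-1}$ for $t>0$. Then the iteration $S_{k+1}=\frac2n\sum_{i=1}^nx_i\,h(x_i^TS_k^{-1}x_i)\,x_i^T$, started from any $S_0\in\mathbb{P}_d$, converges to the unique fixed point in $\mathbb{P}_d$ of the map $S\mapsto\frac2n\sum_{i=1}^nx_i\,h(x_i^TS^{-1}x_i)\,x_i^T$.
   Context: $\mathbb{P}_d$ denotes $d\times d$ real symmetric positive definite matrices. This is the fixed-point equation for maximum-likelihood estimation of the Kotz-type distribution with density generator $\varphi(t)=t^{\alpha-d/2}\exp(-(t/b)^\beta)$. *)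

theory Defs
  imports "HOL-Analysis.Analysis"
begin

definition pos_def_mat :: "real^'d^'d \<Rightarrow> bool" where
  "pos_def_mat S \<longleftrightarrow> transpose S = S \<and> (\<forall>v. v \<noteq> 0 \<longrightarrow> v \<bullet> (S *v v) > 0)"

definition outer :: "real^'d \<Rightarrow> real^'d^'d" where
  "outer x = (\<chi> a b. x $ a * x $ b)"

definition kotz_h :: "real \<Rightarrow> real \<Rightarrow> real \<Rightarrow> real \<Rightarrow> real \<Rightarrow> real" where
  "kotz_h d \<alpha> \<beta> b t = (d/2 - \<alpha>) / t + \<beta> / (b powr \<beta>) * t powr (\<beta> - 1)"

definition kotz_map :: "real \<Rightarrow> real \<Rightarrow> real \<Rightarrow> nat \<Rightarrow> (nat \<Rightarrow> real^'d) \<Rightarrow> real^'d^'d \<Rightarrow> real^'d^'d" where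
  "kotz_map \<alpha> \<beta> b n x S =
     (2 / real n) *\<^sub>R (\<Sum>i<n. kotz_h (real CARD('d)) \<alpha> \<beta> b (x i \<bullet> (matrix_inv S *v x i)) *\<^sub>R outer (x i))"

end

theory Submission
  imports Defs
begin

text \<open>
  Around a positive definite fixed point R the map contracts in Thompson's metric: if S lies
  between R/D and D R in the Loewner order, then its image lies between R/D' and D' R with
  D' - 1 = \<rho> (D - 1) and a fixed \<rho> < 1, because the exponent \<beta> - 1 has modulus below one.
  This yields both uniqueness and convergence from any starting point.

  A fixed point exists because the negative log-likelihood, as a function of the inverse scatter
  matrix P, attains its minimum. For coercivity choose greedily a basis y_0, ..., y_(d-1) among the
  data with the smallest values of the quadratic form of P. Leibniz' formula bounds det P by a
  constant times the product of these values, and the constants are uniform since there are only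
  finitely many bases. Abel summation along the flag spanned by the y_j turns the subspace
  condition into a lower bound that tends to infinity.
\<close>

section \<open>Positive definite matrices\<close>

text \<open>The share of \<open>a/t\<close> in \<open>h t\<close>, where
  \<open>a = d/2 - \<alpha>\<close>, tends to 1 as t tends to 0 whenever \<open>a > 0\<close>. The
  estimate therefore gives no common rate for all pairs of matrices, and a Banach argument does not
  supply existence. At a fixed point R only the finitely many values x_i^T R^-1 x_i enter, which
  leaves a uniform margin. Existence is variational instead: any minimiser yields a fixed point, and
  uniqueness is left to the contraction. The likelihood is written in P, the inverse of S, because
  the forms x_i^T P x_i are linear in P. Replacing P by c P changes its logarithmic part by
  \<open>- \<kappa> * ln c\<close> with \<open>\<kappa> > 0\<close>. So the logarithms penalise
  small P and the power term penalises large P; the subspace condition handles degenerate P, whose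
  forms have very different sizes.\<close>

lemma symmetric_inner_commute:
  fixes S :: "real^'d^'d"
  assumes "transpose S = S"
  shows "u \<bullet> (S *v v) = v \<bullet> (S *v u)"
proof -
  have "u \<bullet> (S *v v) = (u v* S) \<bullet> v"
    by (simp add: dot_lmul_matrix)
  also have "u v* S = S *v u"
    using assms by (metis transpose_matrix_vector)
  finally show ?thesis
    by (simp add: inner_commute)
qed

text \<open>The form at \<open>u + s v\<close> is a polynomial in s that is nowhere negative.
  Definiteness is not assumed, so the leading coefficient may vanish.\<close>

lemma psd_Cauchy_Schwarz:
  fixes S :: "real^'d^'d"
  assumes sym: "transpose S = S" and psd: "\<And>v. 0 \<le> v \<bullet> (S *v v)"
  shows "(u \<bullet> (S *v v))\<^sup>2 \<le> (u \<bullet> (S *v u)) * (v \<bullet> (S *v v))"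
proof -
  define A B C where "A = u \<bullet> (S *v u)" and "B = u \<bullet> (S *v v)" and "C = v \<bullet> (S *v v)"
  have q: "0 \<le> A + 2 * s * B + s\<^sup>2 * C" for s
  proof -
    have "0 \<le> (u + s *\<^sub>R v) \<bullet> (S *v (u + s *\<^sub>R v))"
      by (rule psd)
    also have "\<dots> = A + 2 * s * B + s\<^sup>2 * C"
      using symmetric_inner_commute[OF sym, of u v]
      by (simp add: A_def B_def C_def matrix_vector_right_distrib matrix_vector_mult_scaleR
          inner_add_left inner_add_right algebra_simps power2_eq_square)
    finally show ?thesis .
  qed
  have "B\<^sup>2 \<le> A * C"
  proof (cases "C = 0")
    case True
    have "B = 0"
    proof (rule ccontr)
      assume "B \<noteq> 0"
      \<comment> \<open>With \<open>C = 0\<close> the polynomial is affine in s, and this s gives it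
        the value -1.\<close>
      then show False
        using q[of "- (A + 1) / (2 * B)"] True by (simp add: field_simps)
    qed
    then show ?thesis using True by simp
  next
    case False
    then have "C > 0" using psd[of v] by (simp add: C_def less_le)
    then show ?thesis
      using q[of "- B / C"] by (simp add: field_simps power2_eq_square)
  qed
  then show ?thesis by (simp add: A_def B_def C_def)
qed

lemma pos_def_matD:
  assumes "pos_def_mat S"
  shows "transpose S = S" "v \<noteq> 0 \<Longrightarrow> 0 < v \<bullet> (S *v v)" "0 \<le> v \<bullet> (S *v v)"
  using assms by (auto simp: pos_def_mat_def) (metis inner_zero_left order_less_imp_le order_refl)

lemma pos_def_mat_invertible:
  fixes S :: "real^'d^'d"
  assumes "pos_def_mat S"
  shows "invertible S"
proof -
  have "x = 0" if "S *v x = 0" for x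
    using pos_def_matD(2)[OF assms, of x] that by auto
  then show ?thesis
    using matrix_left_invertible_ker invertible_left_inverse by blast
qed

lemma matrix_inv_mult:
  fixes S :: "real^'d^'d"
  assumes "invertible S"
  shows "S ** matrix_inv S = mat 1" "matrix_inv S ** S = mat 1"
  using someI_ex[of "\<lambda>B. S ** B = mat 1 \<and> B ** S = mat 1"] assms
  unfolding matrix_inv_def invertible_def by blast+

lemma matrix_inv_unique:
  fixes S :: "real^'d^'d"
  assumes "P ** S = mat 1"
  shows "matrix_inv S = P" "matrix_inv P = S"
proof -
  have "S ** P = mat 1" using assms matrix_left_right_inverse by blast
  then have "invertible S" "invertible P" using assms by (auto simp: invertible_def)
  then show "matrix_inv S = P" "matrix_inv P = S"
    using assms \<open>S ** P = mat 1\<close> matrix_inv_mult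
    by (metis matrix_mul_assoc matrix_mul_lid matrix_mul_rid)+
qed

lemma pos_def_mat_inv_mult_vector:
  fixes S :: "real^'d^'d"
  assumes "pos_def_mat S"
  shows "S *v (matrix_inv S *v v) = v" "matrix_inv S *v (S *v v) = v"
  using matrix_inv_mult[OF pos_def_mat_invertible[OF assms]]
  by (simp_all add: matrix_vector_mul_assoc)

lemma pos_def_mat_inv:
  fixes S :: "real^'d^'d"
  assumes "pos_def_mat S"
  shows "pos_def_mat (matrix_inv S)"
proof -
  note inv = matrix_inv_mult[OF pos_def_mat_invertible[OF assms]]
  have "transpose (matrix_inv S) ** S = mat 1"
    using arg_cong[OF inv(1), of transpose] pos_def_matD(1)[OF assms]
    by (simp add: matrix_transpose_mul transpose_mat)
  then have "transpose (matrix_inv S) = matrix_inv S"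
    using matrix_inv_unique(1) by metis
  moreover have "0 < v \<bullet> (matrix_inv S *v v)" if "v \<noteq> 0" for v
  proof -
    let ?w = "matrix_inv S *v v"
    have "?w \<noteq> 0" using that pos_def_mat_inv_mult_vector(1)[OF assms, of v] by auto
    then have "0 < ?w \<bullet> (S *v ?w)" by (rule pos_def_matD(2)[OF assms])
    then show ?thesis by (simp add: pos_def_mat_inv_mult_vector[OF assms] inner_commute)
  qed
  ultimately show ?thesis by (simp add: pos_def_mat_def)
qed

text \<open>Cauchy-Schwarz for A, applied to \<open>w\<close> = B^-1 v and \<open>u\<close> = A^-1
  v, replaces a simultaneous diagonalisation: v.w equals w.(A u), and w.(A w) is at most c times
  w.(B w) = v.w, so one factor v.w cancels.\<close>

lemma pos_def_mat_inv_antimono: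
  fixes A B :: "real^'d^'d"
  assumes A: "pos_def_mat A" and B: "pos_def_mat B" and "c > 0"
    and le: "\<And>v. v \<bullet> (A *v v) \<le> c * (v \<bullet> (B *v v))"
  shows "v \<bullet> (matrix_inv B *v v) \<le> c * (v \<bullet> (matrix_inv A *v v))"
proof -
  define w u where "w = matrix_inv B *v v" and "u = matrix_inv A *v v"
  have [simp]: "B *v w = v" "A *v u = v"
    by (simp_all add: w_def u_def pos_def_mat_inv_mult_vector A B)
  have wv: "0 \<le> v \<bullet> w" using pos_def_matD(3)[OF B, of w] by (simp add: inner_commute)
  have uv: "0 \<le> v \<bullet> u" using pos_def_matD(3)[OF A, of u] by (simp add: inner_commute)
  have "(v \<bullet> w)\<^sup>2 = (w \<bullet> (A *v u))\<^sup>2" by (simp add: inner_commute)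
  also have "\<dots> \<le> (w \<bullet> (A *v w)) * (u \<bullet> (A *v u))"
    by (rule psd_Cauchy_Schwarz) (use pos_def_matD A in blast)+
  also have "\<dots> \<le> (c * (v \<bullet> w)) * (v \<bullet> u)"
    using le[of w] uv by (simp add: inner_commute mult_right_mono)
  finally have "(v \<bullet> w) * (v \<bullet> w) \<le> (v \<bullet> w) * (c * (v \<bullet> u))"
    by (simp add: power2_eq_square mult_ac)
  then have "v \<bullet> w \<le> c * (v \<bullet> u)"
    using wv uv \<open>c > 0\<close> by (cases "v \<bullet> w = 0") (auto simp: mult_le_cancel_left)
  then show ?thesis by (simp add: w_def u_def)
qed

section \<open>Continuity and sign of the determinant, congruences\<close>

lemma continuous_on_det [continuous_intros]:
  fixes f :: "'a::topological_space \<Rightarrow> real^'d^'d"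
  assumes "continuous_on X f"
  shows "continuous_on X (\<lambda>x. det (f x))"
  unfolding det_def by (intro continuous_intros assms)

lemma continuous_on_quadratic_form [continuous_intros]:
  fixes f :: "'a::topological_space \<Rightarrow> real^'d^'d"
  assumes "continuous_on X f"
  shows "continuous_on X (\<lambda>x. v \<bullet> (f x *v w))"
  unfolding inner_vec_def matrix_vector_mult_def by (simp, intro continuous_intros assms)

lemma pos_def_mat_1: "pos_def_mat (mat 1 :: real^'d^'d)"
  by (simp add: pos_def_mat_def transpose_mat)

text \<open>The segment from the identity to S stays inside the positive definite matrices, where
  the determinant cannot vanish; it starts at 1, so it cannot change sign.\<close>

lemma pos_def_mat_det_pos:
  fixes S :: "real^'d^'d"
  assumes S: "pos_def_mat S"
  shows "0 < det S"
proof (rule ccontr)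
  assume neg: "\<not> 0 < det S"
  define F where "F s = (1 - s) *\<^sub>R (mat 1 :: real^'d^'d) + s *\<^sub>R S" for s
  have pd: "pos_def_mat (F s)" if "0 \<le> s" "s \<le> 1" for s
    unfolding pos_def_mat_def
  proof (intro conjI allI impI)
    show "transpose (F s) = F s"
      using pos_def_matD(1)[OF S] by (simp add: F_def transpose_def vec_eq_iff mat_def)
    fix v :: "real^'d" assume "v \<noteq> 0"
    have "v \<bullet> (F s *v v) = (1 - s) * (v \<bullet> v) + s * (v \<bullet> (S *v v))"
      by (simp add: F_def matrix_vector_mult_add_rdistrib inner_add_right
          flip: scaleR_matrix_vector_assoc)
    also have "\<dots> > 0"
    proof (cases "s = 1")
      case False
      then show ?thesis using that pos_def_matD(3)[OF S, of v] \<open>v \<noteq> 0\<close>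
        by (intro add_pos_nonneg) auto
    qed (use pos_def_matD(2)[OF S \<open>v \<noteq> 0\<close>] in auto)
    finally show "0 < v \<bullet> (F s *v v)" .
  qed
  have "\<exists>s\<ge>0. s \<le> 1 \<and> det (F s) = 0"
  proof (rule IVT2')
    show "continuous_on {0..1} (\<lambda>s. det (F s))"
      unfolding F_def by (intro continuous_intros)
  qed (use neg in \<open>auto simp: F_def\<close>)
  then show False
    using pos_def_mat_invertible[OF pd] invertible_det_nz by blast
qed

lemma pos_def_mat_congruence:
  fixes B S :: "real^'d^'d"
  assumes S: "pos_def_mat S" and "det B \<noteq> 0"
  shows "pos_def_mat (transpose B ** S ** B)"
proof -
  have "transpose (transpose B ** S ** B) = transpose B ** S ** B"
    using pos_def_matD(1)[OF S] by (simp add: matrix_transpose_mul matrix_mul_assoc)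
  moreover have "0 < v \<bullet> ((transpose B ** S ** B) *v v)" if "v \<noteq> 0" for v
  proof -
    have "B *v v \<noteq> 0"
      using that assms(2) invertible_det_nz[of B] invertible_left_inverse[of B]
        matrix_left_invertible_ker[of B] by blast
    then have "0 < (B *v v) \<bullet> (S *v (B *v v))" by (rule pos_def_matD(2)[OF S])
    then show ?thesis
      by (metis (no_types, lifting) dot_lmul_matrix inner_commute matrix_vector_mul_assoc
          transpose_matrix_vector)
  qed
  ultimately show ?thesis by (simp add: pos_def_mat_def)
qed

lemma outer_mult_vector: "outer x *v v = (x \<bullet> v) *\<^sub>R x"
  by (simp add: outer_def matrix_vector_mult_def vec_eq_iff inner_vec_def sum_distrib_left
      sum_distrib_right mult_ac)

section \<open>A determinant inequality of Hadamard type\<close>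

text \<open>Leibniz expansion and Cauchy-Schwarz give Hadamard's inequality up to the factor d!.\<close>

lemma psd_det_le_fact_prod:
  fixes A :: "real^'d^'d"
  assumes sym: "transpose A = A" and psd: "\<And>v. 0 \<le> v \<bullet> (A *v v)"
  shows "det A \<le> fact CARD('d) * (\<Prod>j\<in>UNIV. A $ j $ j)"
proof -
  have entry: "axis i 1 \<bullet> (A *v axis j 1) = A $ i $ j" for i j
    by (simp add: matrix_vector_mul_component inner_axis inner_axis' row_def)
  have diag: "0 \<le> A $ j $ j" for j
    using psd[of "axis j 1"] by (simp only: entry)
  have CS: "\<bar>A $ i $ j\<bar> \<le> sqrt (A $ i $ i) * sqrt (A $ j $ j)" for i j
    using psd_Cauchy_Schwarz[OF sym psd, of "axis i 1" "axis j 1"]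
    by (simp only: entry real_sqrt_mult[symmetric]) (simp add: real_le_rsqrt)
  have "det A \<le> (\<Sum>p\<in>{p. p permutes (UNIV::'d set)}. \<Prod>j\<in>UNIV. A $ j $ j)"
    unfolding det_def
  proof (rule sum_mono)
    fix p :: "'d \<Rightarrow> 'd" assume "p \<in> {p. p permutes UNIV}"
    then have p: "p permutes UNIV" by simp
    have "of_int (sign p) * (\<Prod>i\<in>UNIV. A $ i $ p i) \<le> (\<Prod>i\<in>UNIV. \<bar>A $ i $ p i\<bar>)"
      by (auto simp: sign_def abs_prod[symmetric])
    also have "\<dots> \<le> (\<Prod>i\<in>UNIV. sqrt (A $ i $ i) * sqrt (A $ p i $ p i))"
      by (rule prod_mono) (simp add: CS)
    \<comment> \<open>The permutation only reorders the second factors, so all d! Leibniz terms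
      share the same bound.\<close>
    also have "\<dots> = (\<Prod>i\<in>UNIV. sqrt (A $ i $ i)) * (\<Prod>i\<in>UNIV. sqrt (A $ i $ i))"
      using prod.permute[OF p, of "\<lambda>i. sqrt (A $ i $ i)"] by (simp add: prod.distrib o_def)
    also have "\<dots> = (\<Prod>j\<in>UNIV. A $ j $ j)"
      by (simp add: prod.distrib[symmetric] diag)
    finally show "of_int (sign p) * (\<Prod>i\<in>UNIV. A $ i $ p i) \<le> (\<Prod>j\<in>UNIV. A $ j $ j)" .
  qed
  then show ?thesis by (simp add: card_permutations)
qed

lemma matrix_congruence_entry:
  fixes Y P :: "real^'d^'d"
  shows "(Y ** P ** transpose Y) $ j $ k = Y $ j \<bullet> (P *v Y $ k)"
  by (simp add: matrix_matrix_mult_def matrix_vector_mult_def inner_vec_def transpose_def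
      sum_distrib_left sum_distrib_right mult_ac)
     (rule sum.swap)

text \<open>Y P Y^T is the Gram matrix of the rows of Y for the inner product P: its determinant is
  \<open>det P * (det Y)\<^sup>2\<close> and its diagonal carries the forms of the rows.\<close>

lemma det_le_prod_quadratic_forms:
  fixes Y P :: "real^'d^'d"
  assumes P: "pos_def_mat P" and Y: "det Y \<noteq> 0"
  shows "det P * (det Y)\<^sup>2 \<le> fact CARD('d) * (\<Prod>j\<in>UNIV. Y $ j \<bullet> (P *v Y $ j))"
proof -
  have pd: "pos_def_mat (Y ** P ** transpose Y)"
    using pos_def_mat_congruence[OF P, of "transpose Y"] Y by simp
  have "det (Y ** P ** transpose Y) \<le> fact CARD('d) * (\<Prod>j\<in>UNIV. (Y ** P ** transpose Y) $ j $ j)"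
    by (rule psd_det_le_fact_prod) (use pd pos_def_matD in blast)+
  then show ?thesis
    by (simp add: matrix_congruence_entry det_mul power2_eq_square mult_ac)
qed

section \<open>Contraction towards a fixed point\<close>

text \<open>On the logarithmic scale both bounds read |s ln r| <= |s| ln E. The absolute value lets
  \<open>\<beta> < 1\<close> and \<open>\<beta> > 1\<close> be treated together.\<close>

lemma powr_between_le:
  fixes r E s :: real
  assumes "1 \<le> E" "1 / E \<le> r" "r \<le> E"
  shows "r powr s \<le> E powr \<bar>s\<bar>" "inverse (E powr \<bar>s\<bar>) \<le> r powr s"
proof -
  have "0 < r" using assms by (smt (verit) divide_pos_pos)
  have "- ln E = ln (1 / E)" using assms by (simp add: ln_div)
  also have "\<dots> \<le> ln r" using assms \<open>0 < r\<close> by (subst ln_le_cancel_iff) auto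
  finally have "- ln E \<le> ln r" .
  moreover have "ln r \<le> ln E" using assms \<open>0 < r\<close> by (subst ln_le_cancel_iff) auto
  ultimately have "\<bar>ln r\<bar> \<le> ln E" by simp
  then have "\<bar>s * ln r\<bar> \<le> \<bar>s\<bar> * ln E" by (simp add: abs_mult mult_left_mono)
  then have "s * ln r \<le> \<bar>s\<bar> * ln E" "- (\<bar>s\<bar> * ln E) \<le> s * ln r" by linarith+
  then show "r powr s \<le> E powr \<bar>s\<bar>" "inverse (E powr \<bar>s\<bar>) \<le> r powr s"
    using assms \<open>0 < r\<close> by (auto simp: powr_def simp flip: exp_minus)
qed

text \<open>Weighted arithmetic-geometric mean of E and 1. The linear bound is what later makes
  \<open>D - 1\<close> shrink geometrically.\<close>

lemma powr_le_Bernoulli: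
  fixes E \<gamma> :: real
  assumes "0 < E" "0 \<le> \<gamma>" "\<gamma> \<le> 1"
  shows "E powr \<gamma> \<le> 1 + \<gamma> * (E - 1)"
  using Youngs_inequality_0[of \<gamma> "1 - \<gamma>" E 1] assms by (simp add: algebra_simps)

text \<open>The summand a/t alone is only nonexpansive for the metric |ln s - ln t|; the strictly
  positive share of the power of t, whose exponent has modulus below one, makes the sum contract.\<close>

lemma kotz_h_contraction:
  fixes E r t w :: real
  assumes "b > 0" "0 < \<beta>" "\<beta> < 2" "\<alpha> \<le> d / 2" "t > 0"
    and E: "1 \<le> E" "1 / E \<le> r" "r \<le> E"
    and w: "(d/2 - \<alpha>) / t \<le> w * kotz_h d \<alpha> \<beta> b t"
  defines "\<rho> \<equiv> \<bar>\<beta> - 1\<bar> + (1 - \<bar>\<beta> - 1\<bar>) * w"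
  shows "kotz_h d \<alpha> \<beta> b (r * t) \<le> (1 + \<rho> * (E - 1)) * kotz_h d \<alpha> \<beta> b t"
    and "kotz_h d \<alpha> \<beta> b t \<le> (1 + \<rho> * (E - 1)) * kotz_h d \<alpha> \<beta> b (r * t)"
proof -
  have r: "0 < r" using E by (smt (verit) divide_pos_pos)
  define \<gamma> p q G where "\<gamma> = \<bar>\<beta> - 1\<bar>" and "p = (d/2 - \<alpha>) / t"
    and "q = \<beta> / (b powr \<beta>) * t powr (\<beta> - 1)" and "G = 1 + \<gamma> * (E - 1)"
  have \<gamma>: "0 \<le> \<gamma>" "\<gamma> < 1" using assms by (auto simp: \<gamma>_def)
  have p: "0 \<le> p" and q: "0 < q" using assms by (auto simp: p_def q_def)
  have ht: "kotz_h d \<alpha> \<beta> b t = p + q" by (simp add: kotz_h_def p_def q_def)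
  have hrt: "kotz_h d \<alpha> \<beta> b (r * t) = p * (1 / r) + q * r powr (\<beta> - 1)"
    using r \<open>t > 0\<close> by (simp add: kotz_h_def p_def q_def powr_mult mult_ac)
  have G: "E powr \<gamma> \<le> G" using powr_le_Bernoulli[of E \<gamma>] \<gamma> E by (simp add: G_def)
  have "0 \<le> \<gamma> * (E - 1)" using \<gamma> E by simp
  then have G1: "1 \<le> G" by (simp add: G_def)
  have rE: "1 / r \<le> E" "1 / E \<le> 1 / r"
    using E r by (auto simp: field_simps)
  have rG: "r powr (\<beta> - 1) \<le> G"
    using powr_between_le(1)[OF E, of "\<beta> - 1"] G by (simp add: \<gamma>_def)
  have "1 / G \<le> inverse (E powr \<gamma>)"
    using G E by (simp add: inverse_eq_divide frac_le)
  then have rG': "1 / G \<le> r powr (\<beta> - 1)"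
    using powr_between_le(2)[OF E, of "\<beta> - 1"] by (simp add: \<gamma>_def)
  \<comment> \<open>Here p, the singular part of \<open>h t\<close>, may grow by the full factor E
    and q only by G; \<open>p \<le> w * (p + q)\<close> turns the average of the two factors into
    \<open>\<rho>\<close>.\<close>
  have "p * E + q * G = p + q + (\<gamma> * (p + q) + (1 - \<gamma>) * p) * (E - 1)"
    by (simp add: G_def algebra_simps)
  also have "\<dots> \<le> p + q + (\<gamma> * (p + q) + (1 - \<gamma>) * (w * (p + q))) * (E - 1)"
    using w \<gamma> E by (intro add_left_mono mult_right_mono mult_left_mono) (auto simp: ht p_def)
  also have "\<dots> = (1 + \<rho> * (E - 1)) * (p + q)"
    by (simp add: \<rho>_def \<gamma>_def algebra_simps)
  finally have key: "p * E + q * G \<le> (1 + \<rho> * (E - 1)) * (p + q)" .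
  have "p * (1 / r) + q * r powr (\<beta> - 1) \<le> p * E + q * G"
    using p q rE rG by (intro add_mono mult_left_mono) auto
  then show "kotz_h d \<alpha> \<beta> b (r * t) \<le> (1 + \<rho> * (E - 1)) * kotz_h d \<alpha> \<beta> b t"
    using key by (simp add: ht hrt)
  have low: "p / E + q / G \<le> p * (1 / r) + q * r powr (\<beta> - 1)"
    using add_mono[OF mult_left_mono[OF rE(2) p] mult_left_mono[OF rG' less_imp_le[OF q]]] by simp
  have EG: "0 < E * G" using E G1 by simp
  \<comment> \<open>Weighted Cauchy-Schwarz with explicit remainder: the lower bound
    \<open>p / E + q / G\<close> loses no more than the upper bound gained, so the same
    \<open>\<rho>\<close> serves both directions.\<close>
  have "(p * E + q * G) * (p / E + q / G) = (p + q)\<^sup>2 + p * q * (E - G)\<^sup>2 / (E * G)"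
    using E G1 by (simp add: field_simps power2_eq_square)
  then have "(p + q)\<^sup>2 \<le> (p * E + q * G) * (p / E + q / G)"
    using p q EG by simp
  also have "\<dots> \<le> ((1 + \<rho> * (E - 1)) * (p + q)) * (p / E + q / G)"
    using key p q E G1 by (intro mult_right_mono) auto
  finally have "(p + q) * (p + q) \<le> (p + q) * ((1 + \<rho> * (E - 1)) * (p / E + q / G))"
    by (simp add: power2_eq_square mult_ac)
  then have le: "p + q \<le> (1 + \<rho> * (E - 1)) * (p / E + q / G)"
    using p q by (simp add: mult_le_cancel_left_pos)
  have "0 < (1 + \<rho> * (E - 1)) * (p + q)"
    using key p q E G1 by (smt (verit) mult_nonneg_nonneg mult_pos_pos)
  then have "0 < 1 + \<rho> * (E - 1)"
    using p q by (simp add: zero_less_mult_iff)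
  then have "(1 + \<rho> * (E - 1)) * (p / E + q / G) \<le> (1 + \<rho> * (E - 1)) * (p * (1 / r) + q * r powr (\<beta> - 1))"
    using low by (intro mult_left_mono) auto
  then show "kotz_h d \<alpha> \<beta> b t \<le> (1 + \<rho> * (E - 1)) * kotz_h d \<alpha> \<beta> b (r * t)"
    using le by (simp add: ht hrt)
qed

lemma finite_uniform_upper_bound:
  fixes f :: "'a \<Rightarrow> real"
  assumes "finite A" "\<And>i. i \<in> A \<Longrightarrow> f i < u" "l < u"
  shows "\<exists>w. l \<le> w \<and> w < u \<and> (\<forall>i\<in>A. f i \<le> w)"
  using assms by (intro exI[of _ "Max (insert l (f ` A))"]) auto

text \<open>Polarisation: the entries of a symmetric matrix are combinations of its forms at e_i,
  e_j and e_i + e_j. Loewner bounds control only forms, and this passes from them to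
  matrices.\<close>

lemma symmetric_mat_tendstoI:
  fixes S :: "nat \<Rightarrow> real^'d^'d" and R :: "real^'d^'d"
  assumes S: "\<And>k. transpose (S k) = S k" and R: "transpose R = R"
    and lim: "\<And>v. (\<lambda>k. v \<bullet> (S k *v v)) \<longlonglongrightarrow> v \<bullet> (R *v v)"
  shows "S \<longlonglongrightarrow> R"
proof (intro vec_tendstoI)
  fix i j :: 'd
  let ?e = "\<lambda>i. axis i (1::real) :: real^'d"
  have entry: "A $ i $ j = ((?e i + ?e j) \<bullet> (A *v (?e i + ?e j)) - ?e i \<bullet> (A *v ?e i)
      - ?e j \<bullet> (A *v ?e j)) / 2" if "transpose A = A" for A :: "real^'d^'d"
  proof -
    have "A $ i $ j = ?e i \<bullet> (A *v ?e j)"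
      by (simp add: matrix_vector_mul_component inner_axis inner_axis' row_def)
    then show ?thesis
      using symmetric_inner_commute[OF that, of "?e i" "?e j"]
      by (simp add: matrix_vector_right_distrib inner_add_left inner_add_right)
  qed
  have "(\<lambda>k. ((?e i + ?e j) \<bullet> (S k *v (?e i + ?e j)) - ?e i \<bullet> (S k *v ?e i)
      - ?e j \<bullet> (S k *v ?e j)) / 2) \<longlonglongrightarrow>
      ((?e i + ?e j) \<bullet> (R *v (?e i + ?e j)) - ?e i \<bullet> (R *v ?e i)
      - ?e j \<bullet> (R *v ?e j)) / 2"
    by (intro tendsto_intros lim) simp
  then show "(\<lambda>k. S k $ i $ j) \<longlonglongrightarrow> R $ i $ j"
    by (simp only: entry[OF S, symmetric] entry[OF R, symmetric])
qed

text \<open>The quotient of the two forms is homogeneous of degree 0 and continuous on the compact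
  unit sphere. Used in both directions, it shows that any starting point has finite Thompson
  distance from R.\<close>

lemma pos_def_mat_bounded_ratio:
  fixes S R :: "real^'d^'d"
  assumes R: "pos_def_mat R"
  obtains D where "1 \<le> D" "\<And>v. v \<bullet> (S *v v) \<le> D * (v \<bullet> (R *v v))"
proof -
  let ?f = "\<lambda>v. (v \<bullet> (S *v v)) / (v \<bullet> (R *v v))"
  have pos: "0 < v \<bullet> (R *v v)" if "v \<noteq> 0" for v
    using pos_def_matD(2)[OF R that] .
  have "v \<bullet> (R *v v) \<noteq> 0" if "v \<in> sphere 0 1" for v
    using pos[of v] that by fastforce
  then have "continuous_on (sphere 0 1) ?f"
    by (intro continuous_on_divide continuous_on_inner continuous_on_id
        matrix_vector_mult_linear_continuous_on) blast
  then have "bounded (?f ` sphere 0 1)"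
    by (intro compact_imp_bounded compact_continuous_image) auto
  then obtain B where B: "\<forall>y\<in>?f ` sphere 0 1. norm y \<le> B"
    unfolding bounded_iff by blast
  have "v \<bullet> (S *v v) \<le> max 1 B * (v \<bullet> (R *v v))" for v
  proof (cases "v = 0")
    case False
    let ?u = "(1 / norm v) *\<^sub>R v"
    have "?u \<in> sphere 0 1" using False by simp
    then have "norm (?f ?u) \<le> B" using B by blast
    then have "?f ?u \<le> B" by (simp only: real_norm_def abs_le_iff)
    also have "?f ?u = ?f v" using False by (simp add: matrix_vector_mult_scaleR)
    finally have "?f v \<le> max 1 B" by simp
    then show ?thesis using pos[OF False] by (simp add: field_simps)
  qed simp
  then show ?thesis by (intro that[of "max 1 B"]) auto
qed

section \<open>The iteration under the hypotheses on the data\<close>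

locale kotz_estimation =
  fixes x :: "nat \<Rightarrow> real^'d" and n :: nat and \<alpha> \<beta> b :: real
  assumes b: "b > 0" and \<beta>: "0 < \<beta>" "\<beta> < 2" and \<alpha>: "0 < \<alpha>" "\<alpha> \<le> real CARD('d) / 2"
    and span_x: "span (x ` {..<n}) = UNIV"
    and few_in_subspace: "\<And>L. subspace L \<Longrightarrow> 1 \<le> dim L \<Longrightarrow> dim L < CARD('d) \<Longrightarrow>
           (real CARD('d) - 2 * \<alpha>) * real (card {i. i < n \<and> x i \<in> L}) < real n * real (dim L)"
begin

definition h :: "real \<Rightarrow> real" where "h = kotz_h (real CARD('d)) \<alpha> \<beta> b"

abbreviation f :: "real^'d^'d \<Rightarrow> real^'d^'d" where "f \<equiv> kotz_map \<alpha> \<beta> b n x"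

lemma n_pos: "0 < n"
proof (rule ccontr)
  assume "\<not> 0 < n"
  then have "(UNIV :: (real^'d) set) = {0}" using span_x by simp
  then have "(axis undefined 1 :: real^'d) = 0" by blast
  then show False by (simp add: axis_eq_0_iff)
qed

lemma h_pos: "0 < t \<Longrightarrow> 0 < h t"
  using b \<beta> \<alpha> by (simp add: h_def kotz_h_def add_nonneg_pos)

text \<open>A vector orthogonal to all data is orthogonal to their span, hence to itself.\<close>

lemma exists_non_orthogonal:
  assumes "v \<noteq> 0"
  obtains i where "i < n" "x i \<bullet> v \<noteq> 0"
proof -
  have "\<exists>i<n. x i \<bullet> v \<noteq> 0"
  proof (rule ccontr)
    assume "\<not> ?thesis"
    then have "x ` {..<n} \<subseteq> {u. u \<bullet> v = 0}" by auto
    moreover have "subspace {u. u \<bullet> v = 0}"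
      by (simp add: subspace_def inner_add_left)
    ultimately have "span (x ` {..<n}) \<subseteq> {u. u \<bullet> v = 0}"
      by (rule span_minimal)
    then have "v \<bullet> v = 0" using span_x by blast
    then show False using assms by simp
  qed
  then show ?thesis using that by blast
qed

text \<open>Reduces Loewner comparisons of images of the map to comparing the scalar weights
  observation by observation.\<close>

lemma f_quadratic_form:
  "v \<bullet> (f S *v v) = (2 / real n) * (\<Sum>i<n. h (x i \<bullet> (matrix_inv S *v x i)) * (x i \<bullet> v)\<^sup>2)"
proof -
  have sum: "(\<Sum>i\<in>A. F i) *v v = (\<Sum>i\<in>A. F i *v v)"
    if "finite A" for A :: "nat set" and F :: "nat \<Rightarrow> real^'d^'d"
    using that by induction (auto simp: matrix_vector_mult_add_rdistrib)
  show ?thesis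
    unfolding kotz_map_def h_def
    by (simp add: sum outer_mult_vector inner_sum_right power2_eq_square mult_ac
        inner_commute[of v] flip: scaleR_matrix_vector_assoc)
qed

lemma f_symmetric: "transpose (f S) = f S"
  by (simp add: kotz_map_def transpose_def vec_eq_iff outer_def mult.commute)

lemma f_pos_def:
  assumes S: "pos_def_mat S"
  shows "pos_def_mat (f S)"
  unfolding pos_def_mat_def
proof (intro conjI allI impI f_symmetric)
  fix v :: "real^'d" assume "v \<noteq> 0"
  then obtain i where i: "i < n" "x i \<bullet> v \<noteq> 0" by (rule exists_non_orthogonal)
  have pos: "0 < h (x j \<bullet> (matrix_inv S *v x j))" if "x j \<noteq> 0" for j
    using h_pos pos_def_matD(2)[OF pos_def_mat_inv[OF S] that] by simp
  have "0 < (\<Sum>i<n. h (x i \<bullet> (matrix_inv S *v x i)) * (x i \<bullet> v)\<^sup>2)"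
  proof (rule sum_pos2)
    show "0 < h (x i \<bullet> (matrix_inv S *v x i)) * (x i \<bullet> v)\<^sup>2"
      using i pos[of i] by fastforce
    \<comment> \<open>For a zero observation \<open>h_pos\<close> says nothing, but the squared
      factor vanishes.\<close>
    show "0 \<le> h (x j \<bullet> (matrix_inv S *v x j)) * (x j \<bullet> v)\<^sup>2" for j
      using pos[of j] by (cases "x j = 0") auto
  qed (use i in auto)
  then show "0 < v \<bullet> (f S *v v)"
    using n_pos by (simp add: f_quadratic_form)
qed

text \<open>Order bounds pass to the inverses, so each x_i^T S^-1 x_i lies within a factor D of its
  value at R, and the scalar contraction applies to each summand. The rate depends only on the
  values at R, hence neither on S nor on D.\<close>

lemma f_contraction:
  assumes R: "pos_def_mat R" and fix_R: "f R = R"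
  obtains \<rho> where "0 \<le> \<rho>" "\<rho> < 1"
    and "\<And>S D. pos_def_mat S \<Longrightarrow> 1 \<le> D \<Longrightarrow>
      (\<And>v. v \<bullet> (S *v v) \<le> D * (v \<bullet> (R *v v))) \<Longrightarrow> (\<And>v. v \<bullet> (R *v v) \<le> D * (v \<bullet> (S *v v))) \<Longrightarrow>
      (\<forall>v. v \<bullet> (f S *v v) \<le> (1 + \<rho> * (D - 1)) * (v \<bullet> (R *v v)) \<and>
           v \<bullet> (R *v v) \<le> (1 + \<rho> * (D - 1)) * (v \<bullet> (f S *v v)))"
proof -
  define T where "T i = x i \<bullet> (matrix_inv R *v x i)" for i
  define I where "I = {i. i < n \<and> x i \<noteq> 0}"
  have T: "0 < T i" if "x i \<noteq> 0" for i
    unfolding T_def using pos_def_matD(2)[OF pos_def_mat_inv[OF R] that] .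
  \<comment> \<open>The fraction of \<open>h (T i)\<close> that contracts no faster than the
    identity. It is below 1 at each nonzero observation, so its maximum over the finite data leaves
    a margin.\<close>
  define share where "share i = (real CARD('d) / 2 - \<alpha>) / T i / h (T i)" for i
  have "finite I" by (simp add: I_def)
  moreover have "share i < 1" if "i \<in> I" for i
  proof -
    have "(real CARD('d) / 2 - \<alpha>) / T i < h (T i)"
      using T[of i] that b \<beta> by (simp add: h_def kotz_h_def I_def)
    then show ?thesis
      using h_pos[OF T, of i] that unfolding share_def
      by (subst divide_less_eq_1_pos) (auto simp: I_def)
  qed
  ultimately have "\<exists>w\<ge>0. w < 1 \<and> (\<forall>i\<in>I. share i \<le> w)"
    by (intro finite_uniform_upper_bound) auto
  then obtain w where w: "0 \<le> w" "w < 1" and wI: "\<forall>i\<in>I. share i \<le> w"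
    by blast
  define \<rho> where "\<rho> = \<bar>\<beta> - 1\<bar> + (1 - \<bar>\<beta> - 1\<bar>) * w"
  have \<gamma>: "\<bar>\<beta> - 1\<bar> < 1" using \<beta> by linarith
  have "0 \<le> \<rho>" using \<gamma> w by (simp add: \<rho>_def)
  moreover have "\<rho> < 1"
  proof -
    have "(1 - \<bar>\<beta> - 1\<bar>) * w < (1 - \<bar>\<beta> - 1\<bar>) * 1"
      using \<gamma> w by (intro mult_strict_left_mono) auto
    then show ?thesis by (simp add: \<rho>_def)
  qed
  moreover have "\<forall>v. v \<bullet> (f S *v v) \<le> (1 + \<rho> * (D - 1)) * (v \<bullet> (R *v v)) \<and>
      v \<bullet> (R *v v) \<le> (1 + \<rho> * (D - 1)) * (v \<bullet> (f S *v v))"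
    if S: "pos_def_mat S" and D: "1 \<le> D"
      and SR: "\<And>v. v \<bullet> (S *v v) \<le> D * (v \<bullet> (R *v v))"
      and RS: "\<And>v. v \<bullet> (R *v v) \<le> D * (v \<bullet> (S *v v))" for S D
  proof -
    define U where "U i = x i \<bullet> (matrix_inv S *v x i)" for i
    have ratio: "h (U i) \<le> (1 + \<rho> * (D - 1)) * h (T i)" "h (T i) \<le> (1 + \<rho> * (D - 1)) * h (U i)"
      if i: "i < n" "x i \<noteq> 0" for i
    proof -
      have "T i \<le> D * U i"
        unfolding T_def U_def by (rule pos_def_mat_inv_antimono[OF S R]) (use D SR in auto)
      moreover have "U i \<le> D * T i"
        unfolding T_def U_def by (rule pos_def_mat_inv_antimono[OF R S]) (use D RS in auto)
      ultimately have r: "1 / D \<le> U i / T i" "U i / T i \<le> D"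
        using T[OF i(2)] D by (auto simp: field_simps)
      have "(real CARD('d) / 2 - \<alpha>) / T i \<le> w * h (T i)"
        using bspec[OF wI, of i] i h_pos[OF T[OF i(2)]] by (simp add: I_def share_def pos_divide_le_eq del: divide_divide_eq_left)
      \<comment> \<open>Applied at \<open>t = T i\<close> with ratio \<open>r = U i / T i\<close>,
        so that \<open>r * t\<close> is \<open>U i\<close>.\<close>
      note kotz_h_contraction[OF b \<beta> \<alpha>(2) T[OF i(2)] D r this[unfolded h_def], folded \<rho>_def h_def]
      then show "h (U i) \<le> (1 + \<rho> * (D - 1)) * h (T i)" "h (T i) \<le> (1 + \<rho> * (D - 1)) * h (U i)"
        using T[OF i(2)] by auto
    qed
    have scale: "2 / real n * A \<le> K * (2 / real n * B)" if "A \<le> K * B" for A B K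
      using mult_left_mono[OF that, of "2 / real n"] by (simp add: mult_ac)
    show ?thesis
    proof (intro allI conjI)
      fix v
      \<comment> \<open>The fixed point equation writes R as a sum of the same shape, which makes a
        termwise comparison possible.\<close>
      have R': "v \<bullet> (R *v v) = (2 / real n) * (\<Sum>i<n. h (T i) * (x i \<bullet> v)\<^sup>2)"
        using f_quadratic_form[of v R] fix_R by (simp add: T_def)
      have S': "v \<bullet> (f S *v v) = (2 / real n) * (\<Sum>i<n. h (U i) * (x i \<bullet> v)\<^sup>2)"
        by (simp add: f_quadratic_form U_def)
      have "(\<Sum>i<n. h (U i) * (x i \<bullet> v)\<^sup>2) \<le> (\<Sum>i<n. (1 + \<rho> * (D - 1)) * (h (T i) * (x i \<bullet> v)\<^sup>2))"
      proof (rule sum_mono)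
        fix i assume "i \<in> {..<n}"
        then show "h (U i) * (x i \<bullet> v)\<^sup>2 \<le> (1 + \<rho> * (D - 1)) * (h (T i) * (x i \<bullet> v)\<^sup>2)"
          using mult_right_mono[OF ratio(1), of i "(x i \<bullet> v)\<^sup>2"]
          by (cases "x i = 0") (auto simp: mult.assoc)
      qed
      then show "v \<bullet> (f S *v v) \<le> (1 + \<rho> * (D - 1)) * (v \<bullet> (R *v v))"
        unfolding R' S' by (intro scale) (simp only: sum_distrib_left)
      have "(\<Sum>i<n. h (T i) * (x i \<bullet> v)\<^sup>2) \<le> (\<Sum>i<n. (1 + \<rho> * (D - 1)) * (h (U i) * (x i \<bullet> v)\<^sup>2))"
      proof (rule sum_mono)
        fix i assume "i \<in> {..<n}"
        then show "h (T i) * (x i \<bullet> v)\<^sup>2 \<le> (1 + \<rho> * (D - 1)) * (h (U i) * (x i \<bullet> v)\<^sup>2)"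
          using mult_right_mono[OF ratio(2), of i "(x i \<bullet> v)\<^sup>2"]
          by (cases "x i = 0") (auto simp: mult.assoc)
      qed
      then show "v \<bullet> (R *v v) \<le> (1 + \<rho> * (D - 1)) * (v \<bullet> (f S *v v))"
        unfolding R' S' by (intro scale) (simp only: sum_distrib_left)
    qed
  qed
  ultimately show ?thesis by (rule that)
qed

lemma iterates_converge_to_fixed_point:
  assumes R: "pos_def_mat R" and fix_R: "f R = R" and S: "pos_def_mat S"
  shows "(\<lambda>k. (f ^^ k) S) \<longlonglongrightarrow> R"
proof -
  obtain D1 where D1: "1 \<le> D1" "\<And>v. v \<bullet> (S *v v) \<le> D1 * (v \<bullet> (R *v v))"
    using pos_def_mat_bounded_ratio[OF R] by metis
  obtain D2 where D2: "1 \<le> D2" "\<And>v. v \<bullet> (R *v v) \<le> D2 * (v \<bullet> (S *v v))"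
    using pos_def_mat_bounded_ratio[OF S] by metis
  obtain \<rho> where \<rho>: "0 \<le> \<rho>" "\<rho> < 1"
    and step: "\<And>S D. pos_def_mat S \<Longrightarrow> 1 \<le> D \<Longrightarrow>
      (\<And>v. v \<bullet> (S *v v) \<le> D * (v \<bullet> (R *v v))) \<Longrightarrow> (\<And>v. v \<bullet> (R *v v) \<le> D * (v \<bullet> (S *v v))) \<Longrightarrow>
      (\<forall>v. v \<bullet> (f S *v v) \<le> (1 + \<rho> * (D - 1)) * (v \<bullet> (R *v v)) \<and>
           v \<bullet> (R *v v) \<le> (1 + \<rho> * (D - 1)) * (v \<bullet> (f S *v v)))"
    using f_contraction[OF R fix_R] by metis
  define M where "M = max D1 D2"
  \<comment> \<open>The solution of D(k+1) = 1 + \<rho> (D(k) - 1) with D(0) = M.\<close>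
  define D where "D k = 1 + \<rho> ^ k * (M - 1)" for k
  have "1 \<le> M" using D1(1) by (simp add: M_def)
  then have D_ge_1: "1 \<le> D k" for k using \<rho> by (simp add: D_def)
  have pd: "pos_def_mat ((f ^^ k) S)" for k
    by (induction k) (auto simp: S f_pos_def)
  have bound: "\<forall>v. v \<bullet> ((f ^^ k) S *v v) \<le> D k * (v \<bullet> (R *v v)) \<and>
      v \<bullet> (R *v v) \<le> D k * (v \<bullet> ((f ^^ k) S *v v))" for k
  proof (induction k)
    case 0
    show ?case
    proof
      fix v
      have "D1 * (v \<bullet> (R *v v)) \<le> M * (v \<bullet> (R *v v))" "D2 * (v \<bullet> (S *v v)) \<le> M * (v \<bullet> (S *v v))"
        using pos_def_matD(3)[OF R] pos_def_matD(3)[OF S] by (auto simp: M_def intro: mult_right_mono)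
      then show "v \<bullet> ((f ^^ 0) S *v v) \<le> D 0 * (v \<bullet> (R *v v)) \<and>
          v \<bullet> (R *v v) \<le> D 0 * (v \<bullet> ((f ^^ 0) S *v v))"
        using D1(2)[of v] D2(2)[of v] by (simp add: D_def)
    qed
  next
    case (Suc k)
    have "1 + \<rho> * (D k - 1) = D (Suc k)" by (simp add: D_def)
    then show ?case using step[OF pd D_ge_1, of k k] Suc by simp
  qed
  show ?thesis
  proof (rule symmetric_mat_tendstoI)
    fix v
    let ?r = "v \<bullet> (R *v v)"
    have "(\<lambda>k. \<rho> ^ k) \<longlonglongrightarrow> 0" using \<rho> by (intro LIMSEQ_realpow_zero) auto
    then have "(\<lambda>k. 1 + \<rho> ^ k * (M - 1)) \<longlonglongrightarrow> 1 + 0 * (M - 1)"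
      by (intro tendsto_add tendsto_mult tendsto_const)
    then have lim: "D \<longlonglongrightarrow> 1" by (simp add: D_def[abs_def])
    show "(\<lambda>k. v \<bullet> ((f ^^ k) S *v v)) \<longlonglongrightarrow> ?r"
    proof (rule tendsto_sandwich)
      show "\<forall>\<^sub>F k in sequentially. ?r / D k \<le> v \<bullet> ((f ^^ k) S *v v)"
        using bound D_ge_1 by (intro always_eventually allI) (smt (verit) divide_le_eq mult.commute)
      show "\<forall>\<^sub>F k in sequentially. v \<bullet> ((f ^^ k) S *v v) \<le> D k * ?r"
        using bound by simp
      show "(\<lambda>k. ?r / D k) \<longlonglongrightarrow> ?r" "(\<lambda>k. D k * ?r) \<longlonglongrightarrow> ?r"
        using lim by (auto intro!: tendsto_eq_intros)
    qed
  qed (use pd R pos_def_matD in blast)+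
qed

text \<open>The iteration started at a second fixed point is constant, yet converges to the
  first.\<close>

lemma fixed_point_unique:
  assumes "pos_def_mat R" "f R = R" "pos_def_mat S" "f S = S"
  shows "S = R"
proof -
  have "(f ^^ k) S = S" for k by (induction k) (auto simp: assms)
  then show ?thesis
    using iterates_converge_to_fixed_point[OF assms(1-3)] by (simp add: LIMSEQ_const_iff)
qed

end

section \<open>Coercivity of the negative log-likelihood\<close>

text \<open>Fewer than d vectors do not span, so some datum lies outside their span; one of least
  \<open>t\<close> is taken. Minimality is recorded against all data outside the current span, which
  later bounds every observation and not only the chosen ones.\<close>

lemma greedy_independent_sequence:
  fixes x :: "nat \<Rightarrow> real^'d" and t :: "nat \<Rightarrow> real"
  assumes span: "span (x ` {..<n}) = UNIV" and "k \<le> CARD('d)"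
  shows "\<exists>y. \<forall>l<k. y l < n \<and> x (y l) \<notin> span (x ` y ` {..<l}) \<and>
           (\<forall>i<n. x i \<notin> span (x ` y ` {..<l}) \<longrightarrow> t (y l) \<le> t i)"
  using \<open>k \<le> CARD('d)\<close>
proof (induction k)
  case (Suc k)
  then obtain y where y: "\<forall>l<k. y l < n \<and> x (y l) \<notin> span (x ` y ` {..<l}) \<and>
           (\<forall>i<n. x i \<notin> span (x ` y ` {..<l}) \<longrightarrow> t (y l) \<le> t i)"
    by auto
  define V where "V = span (x ` y ` {..<k})"
  have "dim V \<le> card (x ` y ` {..<k})"
    unfolding V_def by (simp add: dim_le_card')
  also have "\<dots> \<le> k"
    using card_image_le[of "{..<k}" "\<lambda>l. x (y l)"] by (simp add: image_image)
  finally have "V \<noteq> UNIV" using Suc.prems by auto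
  have "subspace V" by (simp add: V_def)
  define A where "A = {i. i < n \<and> x i \<notin> V}"
  have "A \<noteq> {}"
  proof
    assume "A = {}"
    then have "x ` {..<n} \<subseteq> V" by (auto simp: A_def)
    then have "span (x ` {..<n}) \<subseteq> V" using \<open>subspace V\<close> by (rule span_minimal)
    then show False using span \<open>V \<noteq> UNIV\<close> by auto
  qed
  moreover have "finite A" by (simp add: A_def)
  ultimately obtain i where i: "i \<in> A" "\<forall>j\<in>A. t i \<le> t j"
    using arg_min_if_finite[of A t] by (metis not_less)
  have img: "(y(k := i)) ` {..<l} = y ` {..<l}" if "l \<le> k" for l
    using that by (intro image_cong) auto
  show ?case
  proof (intro exI[of _ "y(k := i)"] allI impI)
    fix l assume "l < Suc k"
    then consider "l < k" | "l = k" by linarith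
    then show "(y(k := i)) l < n \<and> x ((y(k := i)) l) \<notin> span (x ` (y(k := i)) ` {..<l}) \<and>
           (\<forall>j<n. x j \<notin> span (x ` (y(k := i)) ` {..<l}) \<longrightarrow> t ((y(k := i)) l) \<le> t j)"
    proof cases
      case 1
      then show ?thesis using y by (simp only: img less_imp_le) simp
    next
      case 2
      then show ?thesis using i by (simp only: img order_refl) (simp add: A_def V_def)
    qed
  qed
qed simp

section \<open>Dimension and summation by parts along a flag\<close>

lemma dim_independent_sequence:
  fixes v :: "nat \<Rightarrow> real^'d"
  assumes "\<And>l. l < k \<Longrightarrow> v l \<notin> span (v ` {..<l})"
  shows "dim (v ` {..<k}) = k"
  using assms
proof (induction k)
  case (Suc k)
  have "v ` {..<Suc k} = insert (v k) (v ` {..<k})"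
    by (simp add: lessThan_Suc)
  then show ?case using Suc by (simp add: dim_insert)
qed simp

text \<open>Abel summation; the weight \<open>Suc l\<close> will be the dimension of the flag space
  belonging to the increment.\<close>

lemma sum_by_increments:
  fixes \<tau> :: "nat \<Rightarrow> real"
  shows "(\<Sum>j\<le>m. \<tau> j) = real (Suc m) * \<tau> m - (\<Sum>l<m. real (Suc l) * (\<tau> (Suc l) - \<tau> l))"
  by (induction m) (auto simp: algebra_simps)

text \<open>Telescoping from j on. The condition \<open>j \<le> l\<close> will express that an
  observation first captured at step j lies in the flag space of dimension l + 1.\<close>

lemma sum_increments_from:
  fixes \<tau> :: "nat \<Rightarrow> real"
  assumes "j \<le> m"
  shows "(\<Sum>l<m. (\<tau> (Suc l) - \<tau> l) * of_bool (j \<le> l)) = \<tau> m - \<tau> j"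
  using assms
proof (induction m rule: dec_induct)
  case base
  show ?case by simp
qed auto

text \<open>Expand both sums in the nonnegative increments of \<open>\<tau>\<close>. The coefficient
  of the l-th one becomes the subspace gap \<open>c * (l + 1) - a * card\<close>, at least
  \<open>\<delta>\<close>, and the increments telescope; what remains is a multiple of
  \<open>\<tau> m\<close>.\<close>

lemma weighted_sum_lower_bound:
  fixes \<tau> :: "nat \<Rightarrow> real" and s :: "'a \<Rightarrow> real" and J :: "nat \<Rightarrow> 'a set"
  assumes mono: "\<And>l. l < m \<Longrightarrow> \<tau> l \<le> \<tau> (Suc l)"
    and fin: "finite I" and "0 \<le> a"
    and s: "\<And>i. i \<in> I \<Longrightarrow> \<tau> m - (\<Sum>l<m. (\<tau> (Suc l) - \<tau> l) * of_bool (i \<in> J l)) \<le> s i"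
    and gap: "\<And>l. l < m \<Longrightarrow> \<delta> \<le> c * real (Suc l) - a * real (card {i \<in> I. i \<in> J l})"
  shows "(a * real (card I) - c * real (Suc m)) * \<tau> m + \<delta> * (\<tau> m - \<tau> 0)
         \<le> a * (\<Sum>i\<in>I. s i) - c * (\<Sum>j\<le>m. \<tau> j)"
proof -
  let ?\<Delta> = "\<lambda>l. \<tau> (Suc l) - \<tau> l"
  have "(\<Sum>i\<in>I. \<tau> m - (\<Sum>l<m. ?\<Delta> l * of_bool (i \<in> J l))) \<le> (\<Sum>i\<in>I. s i)"
    by (intro sum_mono s)
  also have "(\<Sum>i\<in>I. \<tau> m - (\<Sum>l<m. ?\<Delta> l * of_bool (i \<in> J l)))
      = real (card I) * \<tau> m - (\<Sum>l<m. \<Sum>i\<in>I. ?\<Delta> l * of_bool (i \<in> J l))"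
    by (subst sum.swap) (simp add: sum_subtractf)
  also have "(\<Sum>l<m. \<Sum>i\<in>I. ?\<Delta> l * of_bool (i \<in> J l))
      = (\<Sum>l<m. ?\<Delta> l * real (card {i \<in> I. i \<in> J l}))"
    using fin by (intro sum.cong refl) (simp add: sum_distrib_left[symmetric] of_bool_def
        sum.If_cases Int_def)
  finally have "a * (real (card I) * \<tau> m - (\<Sum>l<m. ?\<Delta> l * real (card {i \<in> I. i \<in> J l})))
      \<le> a * (\<Sum>i\<in>I. s i)"
    using \<open>0 \<le> a\<close> by (rule mult_left_mono)
  moreover have "(\<Sum>l<m. ?\<Delta> l * \<delta>) \<le> (\<Sum>l<m. ?\<Delta> l * (c * real (Suc l) - a * real (card {i \<in> I. i \<in> J l})))"
    by (intro sum_mono mult_left_mono gap) (auto simp: mono)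
  moreover have "(\<Sum>l<m. ?\<Delta> l * \<delta>) = \<delta> * (\<tau> m - \<tau> 0)"
    unfolding sum_distrib_right[symmetric] sum_lessThan_telescope by (rule mult.commute)
  moreover have "(\<Sum>l<m. ?\<Delta> l * (c * real (Suc l) - a * real (card {i \<in> I. i \<in> J l})))
      = c * (\<Sum>l<m. real (Suc l) * ?\<Delta> l) - a * (\<Sum>l<m. ?\<Delta> l * real (card {i \<in> I. i \<in> J l}))"
    by (simp add: sum_subtractf[symmetric] sum_distrib_left right_diff_distrib mult_ac)
  ultimately show ?thesis
    unfolding sum_by_increments[of \<tau> m] by (simp add: algebra_simps)
qed

lemma finite_uniform_lower_bound:
  fixes f :: "'a \<Rightarrow> real"
  assumes "finite A" "\<And>i. i \<in> A \<Longrightarrow> 0 < f i"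
  shows "\<exists>w>0. \<forall>i\<in>A. w \<le> f i"
  using assms by (intro exI[of _ "Min (insert 1 (f ` A))"]) auto

section \<open>Lower bounds for the likelihood\<close>

context kotz_estimation
begin

text \<open>Zero observations contribute nothing to the map, but ln 0 must be kept out of the
  likelihood.\<close>

definition I :: "nat set" where "I = {i. i < n \<and> x i \<noteq> 0}"

definition a :: real where "a = real CARD('d) / 2 - \<alpha>"

text \<open>The scaling degree: replacing P by c P adds \<open>- \<kappa> * ln c\<close> to the
  logarithmic part of the likelihood.\<close>

definition \<kappa> :: real where "\<kappa> = real n * real CARD('d) / 2 - a * real (card I)"

lemma finite_I: "finite I"
  by (simp add: I_def)

lemma a_nonneg: "0 \<le> a"
  using \<alpha> by (simp add: a_def)

text \<open>At most n observations are nonzero, and \<open>\<alpha> > 0\<close> makes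
  \<open>a\<close> smaller than d/2.\<close>

lemma kappa_pos: "0 < \<kappa>"
proof -
  have "card I \<le> n" using card_mono[of "{..<n}" I] by (auto simp: I_def)
  then have "a * real (card I) \<le> a * real n"
    using a_nonneg by (intro mult_left_mono) auto
  also have "\<dots> < real n * real CARD('d) / 2"
    using n_pos \<alpha> by (simp add: a_def field_simps)
  finally show ?thesis by (simp add: \<kappa>_def)
qed

lemma form_pos: "pos_def_mat P \<Longrightarrow> i \<in> I \<Longrightarrow> 0 < x i \<bullet> (P *v x i)"
  using pos_def_matD(2) by (auto simp: I_def)

text \<open>There are infinitely many subspaces, but the gap depends only on the dimension and the
  number of observations inside, and such pairs are finite in number.\<close>

lemma uniform_subspace_gap:
  obtains \<delta> where "0 < \<delta>" and "\<And>L. subspace L \<Longrightarrow> 1 \<le> dim L \<Longrightarrow> dim L < CARD('d) \<Longrightarrow>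
    \<delta> \<le> real n / 2 * real (dim L) - a * real (card {i \<in> I. x i \<in> L})"
proof -
  define gap where "gap = (\<lambda>(l, N). real n / 2 * real l - a * real N)"
  have "\<exists>w>0. \<forall>p\<in>{p \<in> {..CARD('d)} \<times> {..n}. 0 < gap p}. w \<le> gap p"
    by (rule finite_uniform_lower_bound) auto
  then obtain \<delta> where \<delta>: "0 < \<delta>"
    "\<And>p. p \<in> {..CARD('d)} \<times> {..n} \<Longrightarrow> 0 < gap p \<Longrightarrow> \<delta> \<le> gap p"
    by auto
  have "\<delta> \<le> gap (dim L, card {i \<in> I. x i \<in> L})"
    if L: "subspace L" "1 \<le> dim L" "dim L < CARD('d)" for L
  proof (rule \<delta>(2))
    have "card {i \<in> I. x i \<in> L} \<le> card {..<n}"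
      by (rule card_mono) (auto simp: I_def)
    then show "(dim L, card {i \<in> I. x i \<in> L}) \<in> {..CARD('d)} \<times> {..n}"
      using L by auto
    have "a * real (card {i \<in> I. x i \<in> L}) \<le> a * real (card {i. i < n \<and> x i \<in> L})"
      using a_nonneg by (intro mult_left_mono of_nat_mono card_mono) (auto simp: I_def)
    also have "\<dots> < real n / 2 * real (dim L)"
      using few_in_subspace[OF L] by (simp add: a_def field_simps)
    finally show "0 < gap (dim L, card {i \<in> I. x i \<in> L})" by (simp add: gap_def)
  qed
  then show ?thesis using \<delta>(1) by (intro that[of \<delta>]) (auto simp: gap_def)
qed

lemma uniform_det_bound:
  obtains \<epsilon> where "0 < \<epsilon>" and "\<And>y :: 'd \<Rightarrow> nat. (\<And>j. y j < n) \<Longrightarrow>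
    det ((\<chi> j. x (y j)) :: real^'d^'d) \<noteq> 0 \<Longrightarrow> \<epsilon> \<le> (det ((\<chi> j. x (y j)) :: real^'d^'d))\<^sup>2"
proof -
  let ?Y = "\<lambda>y :: 'd \<Rightarrow> nat. (\<chi> j. x (y j)) :: real^'d^'d"
  have "finite {y :: 'd \<Rightarrow> nat. \<forall>j. y j < n}"
    using finite_PiE[of "UNIV :: 'd set" "\<lambda>_. {..<n}"] by (simp add: PiE_def Pi_def lessThan_def)
  then have "\<exists>w>0. \<forall>y\<in>{y. (\<forall>j. y j < n) \<and> det (?Y y) \<noteq> 0}. w \<le> (det (?Y y))\<^sup>2"
    by (intro finite_uniform_lower_bound) auto
  then show ?thesis using that by auto
qed

text \<open>Here p and q are the first and the last greedy choice: p has the least form of all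
  nonzero data, q the largest within the basis. The term with \<open>\<kappa>\<close> measures the
  scale of P and the term with \<open>\<delta>\<close> its degeneracy.\<close>

lemma log_det_bound:
  "\<exists>C. \<exists>\<delta>>0. \<forall>P. pos_def_mat P \<longrightarrow> (\<exists>p\<in>I. \<exists>q\<in>I.
    (\<forall>i\<in>I. x p \<bullet> (P *v x p) \<le> x i \<bullet> (P *v x i)) \<and>
    - C - \<kappa> * ln (x q \<bullet> (P *v x q)) + \<delta> * (ln (x q \<bullet> (P *v x q)) - ln (x p \<bullet> (P *v x p)))
    \<le> a * (\<Sum>i\<in>I. ln (x i \<bullet> (P *v x i))) - real n / 2 * ln (det P))"
proof -
  obtain \<delta> where \<delta>: "0 < \<delta>" "\<And>L. subspace L \<Longrightarrow> 1 \<le> dim L \<Longrightarrow> dim L < CARD('d) \<Longrightarrow>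
    \<delta> \<le> real n / 2 * real (dim L) - a * real (card {i \<in> I. x i \<in> L})"
    using uniform_subspace_gap by blast
  obtain \<epsilon> where \<epsilon>: "0 < \<epsilon>" "\<And>y :: 'd \<Rightarrow> nat. (\<And>j. y j < n) \<Longrightarrow>
    det ((\<chi> j. x (y j)) :: real^'d^'d) \<noteq> 0 \<Longrightarrow> \<epsilon> \<le> (det ((\<chi> j. x (y j)) :: real^'d^'d))\<^sup>2"
    using uniform_det_bound by blast
  define m where "m = CARD('d) - 1"
  have m: "CARD('d) = Suc m" by (simp add: m_def)
  define C where "C = real n / 2 * (ln (fact CARD('d)) - ln \<epsilon>)"
  have "\<exists>p\<in>I. \<exists>q\<in>I.
    (\<forall>i\<in>I. x p \<bullet> (P *v x p) \<le> x i \<bullet> (P *v x i)) \<and>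
    - C - \<kappa> * ln (x q \<bullet> (P *v x q)) + \<delta> * (ln (x q \<bullet> (P *v x q)) - ln (x p \<bullet> (P *v x p)))
    \<le> a * (\<Sum>i\<in>I. ln (x i \<bullet> (P *v x i))) - real n / 2 * ln (det P)"
    if P: "pos_def_mat P" for P
  proof -
    define t where "t i = x i \<bullet> (P *v x i)" for i
    have t_pos: "0 < t i" if "i \<in> I" for i
      using form_pos[OF P that] by (simp add: t_def)
    obtain y where y: "\<And>l. l < CARD('d) \<Longrightarrow> y l < n"
      "\<And>l. l < CARD('d) \<Longrightarrow> x (y l) \<notin> span (x ` y ` {..<l})"
      "\<And>l i. l < CARD('d) \<Longrightarrow> i < n \<Longrightarrow> x i \<notin> span (x ` y ` {..<l}) \<Longrightarrow> t (y l) \<le> t i"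
      using greedy_independent_sequence[OF span_x order_refl, of t] by blast
    define V where "V l = span (x ` y ` {..<l})" for l
    have V_mono: "V l \<subseteq> V k" if "l \<le> k" for l k
      unfolding V_def using that by (intro span_mono image_mono) auto
    have dim_V: "dim (V l) = l" if "l \<le> CARD('d)" for l
      using dim_independent_sequence[of l "\<lambda>l. x (y l)"] y(2) that
      by (simp add: V_def image_image)
    have V_full: "V (CARD('d)) = UNIV"
      using dim_V[of "CARD('d)"] dim_eq_full[of "x ` y ` {..<CARD('d)}"] by (simp add: V_def)
    have yI: "y l \<in> I" if "l < CARD('d)" for l
    proof -
      have "x (y l) \<noteq> 0" using y(2)[OF that] span_zero[of "x ` y ` {..<l}"] by metis
      then show ?thesis using y(1)[OF that] by (simp add: I_def)
    qed
    define \<tau> where "\<tau> l = ln (t (y l))" for l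
    have \<tau>_mono: "\<tau> l \<le> \<tau> (Suc l)" if "l < m" for l
    proof -
      have "x (y (Suc l)) \<notin> V l"
        using y(2)[of "Suc l"] V_mono[of l "Suc l"] that m by (auto simp: V_def)
      then have "t (y l) \<le> t (y (Suc l))"
        using y(3)[of l "y (Suc l)"] y(1)[of "Suc l"] that m by (simp add: V_def)
      then show ?thesis
        unfolding \<tau>_def using t_pos[OF yI, of l] t_pos[OF yI, of "Suc l"] that m by simp
    qed
    have s: "\<tau> m - (\<Sum>l<m. (\<tau> (Suc l) - \<tau> l) * of_bool (i \<in> {i. x i \<in> V (Suc l)})) \<le> ln (t i)"
      if i: "i \<in> I" for i
    proof -
      \<comment> \<open>The greedy step at which \<open>x i\<close> enters the flag. Before it
        \<open>x i\<close> was still a candidate, hence \<open>t (y j) \<le> t i\<close>; for j = 0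
        this uses \<open>x i \<noteq> 0\<close>.\<close>
      define j where "j = (LEAST j. x i \<in> V (Suc j))"
      have full: "x i \<in> V (Suc m)" using V_full m by simp
      have jm: "j \<le> m" unfolding j_def using full by (rule Least_le)
      have xj: "x i \<in> V (Suc j)" unfolding j_def using full by (rule LeastI)
      have "x i \<notin> V j"
      proof (cases j)
        case 0
        then show ?thesis using i by (simp add: V_def I_def)
      next
        case (Suc k)
        then show ?thesis using not_less_Least[of k "\<lambda>j. x i \<in> V (Suc j)"] by (simp add: j_def)
      qed
      then have "t (y j) \<le> t i"
        using y(3)[of j i] i jm m by (simp add: V_def I_def)
      then have "\<tau> j \<le> ln (t i)"
        unfolding \<tau>_def using t_pos[OF yI, of j] t_pos[OF i] jm m by simp
      moreover have "x i \<in> V (Suc l) \<longleftrightarrow> j \<le> l" for l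
        using Least_le[of "\<lambda>j. x i \<in> V (Suc j)" l] V_mono[of "Suc j" "Suc l"] xj
        by (auto simp: j_def)
      ultimately show ?thesis
        using sum_increments_from[OF jm, of \<tau>] by simp
    qed
    have gap: "\<delta> \<le> real n / 2 * real (Suc l) - a * real (card {i \<in> I. i \<in> {i. x i \<in> V (Suc l)}})"
      if "l < m" for l
      using \<delta>(2)[of "V (Suc l)"] dim_V[of "Suc l"] that m by (simp add: V_def)
    have main: "(a * real (card I) - real n / 2 * real (Suc m)) * \<tau> m + \<delta> * (\<tau> m - \<tau> 0)
         \<le> a * (\<Sum>i\<in>I. ln (t i)) - real n / 2 * (\<Sum>j\<le>m. \<tau> j)"
      by (rule weighted_sum_lower_bound[OF \<tau>_mono finite_I a_nonneg s gap])
    \<comment> \<open>Rows of a matrix are indexed by the type \<open>'d\<close>, the greedy basis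
      by naturals; g translates.\<close>
    obtain g where g: "bij_betw g (UNIV :: 'd set) {..<CARD('d)}"
      using ex_bij_betw_finite_nat[of "UNIV :: 'd set"] by (auto simp: lessThan_atLeast0)
    have g_less: "g j < CARD('d)" for j using g by (auto simp: bij_betw_def)
    define Y :: "real^'d^'d" where "Y = (\<chi> j. x (y (g j)))"
    have "rows Y = (\<lambda>l. x (y l)) ` g ` UNIV"
      by (auto simp: rows_def row_def Y_def)
    also have "\<dots> = x ` y ` {..<CARD('d)}"
      using g by (simp add: bij_betw_def image_image)
    finally have "span (rows Y) = UNIV" using V_full by (simp add: V_def)
    then have "det Y \<noteq> 0"
      using matrix_left_invertible_span_rows[of Y] invertible_left_inverse[of Y] invertible_det_nz[of Y]
      by simp
    have "\<epsilon> \<le> (det Y)\<^sup>2"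
      using \<epsilon>(2)[of "\<lambda>j. y (g j)"] \<open>det Y \<noteq> 0\<close> y(1)[OF g_less] by (simp add: Y_def)
    have det_pos: "0 < det P" by (rule pos_def_mat_det_pos[OF P])
    have "det P * \<epsilon> \<le> det P * (det Y)\<^sup>2"
      using \<open>\<epsilon> \<le> (det Y)\<^sup>2\<close> det_pos by simp
    also have "\<dots> \<le> fact CARD('d) * (\<Prod>j\<in>UNIV. t (y (g j)))"
      using det_le_prod_quadratic_forms[OF P \<open>det Y \<noteq> 0\<close>] by (simp add: Y_def t_def)
    also have "(\<Prod>j\<in>UNIV. t (y (g j))) = (\<Prod>l\<le>m. t (y l))"
      using prod.reindex_bij_betw[OF g, of "\<lambda>l. t (y l)"] by (simp add: m lessThan_Suc_atMost)
    finally have "det P * \<epsilon> \<le> fact CARD('d) * (\<Prod>l\<le>m. t (y l))" .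
    then have "ln (det P * \<epsilon>) \<le> ln (fact CARD('d) * (\<Prod>l\<le>m. t (y l)))"
      using det_pos \<epsilon>(1) by (intro ln_mono) auto
    moreover have ty: "0 < t (y l)" if "l \<le> m" for l
      using t_pos[OF yI, of l] that m by simp
    then have "0 < (\<Prod>l\<le>m. t (y l))"
      by (intro prod_pos) auto
    moreover have "ln (\<Prod>l\<le>m. t (y l)) = (\<Sum>l\<le>m. \<tau> l)"
      unfolding \<tau>_def by (intro ln_prod) (use ty in force)+
    ultimately have "ln (det P) \<le> ln (fact CARD('d)) - ln \<epsilon> + (\<Sum>l\<le>m. \<tau> l)"
      using ln_mult_pos[OF det_pos \<epsilon>(1)] ln_mult_pos[of "fact CARD('d)" "\<Prod>l\<le>m. t (y l)"]
      by simp
    then have "real n / 2 * ln (det P) \<le> real n / 2 * (ln (fact CARD('d)) - ln \<epsilon> + (\<Sum>l\<le>m. \<tau> l))"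
      by (intro mult_left_mono) auto
    then have "real n / 2 * ln (det P) \<le> C + real n / 2 * (\<Sum>l\<le>m. \<tau> l)"
      by (simp add: C_def algebra_simps)
    moreover have "a * real (card I) - real n / 2 * real (Suc m) = - \<kappa>"
      by (simp add: \<kappa>_def m)
    ultimately have "- C - \<kappa> * \<tau> m + \<delta> * (\<tau> m - \<tau> 0) \<le> a * (\<Sum>i\<in>I. ln (t i)) - real n / 2 * ln (det P)"
      using main by simp
    moreover have "t (y 0) \<le> t i" if "i \<in> I" for i
      using y(3)[of 0 i] that by (simp add: I_def)
    ultimately show ?thesis
      using yI[of 0] yI[of m] m unfolding \<tau>_def t_def by (intro bexI[of _ "y 0"] bexI[of _ "y m"]) auto
  qed
  then show ?thesis using \<delta>(1) by (intro exI[of _ C] exI[of _ \<delta>]) simp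
qed

text \<open>The negative log-likelihood as a function of the inverse scatter matrix P.\<close>

definition \<Psi> :: "real^'d^'d \<Rightarrow> real" where
  "\<Psi> P = a * (\<Sum>i\<in>I. ln (x i \<bullet> (P *v x i))) - real n / 2 * ln (det P)
     + (\<Sum>i\<in>I. (x i \<bullet> (P *v x i)) powr \<beta>) / b powr \<beta>"

text \<open>Half of the power term absorbs \<open>\<kappa> * ln (t q)\<close>. The other half bounds
  all forms from above, the \<open>\<delta>\<close> term bounds ln t_q - ln t_p, and the
  \<open>\<kappa>\<close> term bounds t_q from below, so the least form t_p stays away from
  0.\<close>

lemma sublevel_bounds:
  obtains lo hi where "0 < lo" and "\<And>P i. pos_def_mat P \<Longrightarrow> \<Psi> P \<le> K \<Longrightarrow> i \<in> I \<Longrightarrow>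
    lo \<le> x i \<bullet> (P *v x i) \<and> x i \<bullet> (P *v x i) \<le> hi"
proof -
  obtain C \<delta> where \<delta>: "0 < \<delta>" and bound: "\<forall>P. pos_def_mat P \<longrightarrow> (\<exists>p\<in>I. \<exists>q\<in>I.
    (\<forall>i\<in>I. x p \<bullet> (P *v x p) \<le> x i \<bullet> (P *v x i)) \<and>
    - C - \<kappa> * ln (x q \<bullet> (P *v x q)) + \<delta> * (ln (x q \<bullet> (P *v x q)) - ln (x p \<bullet> (P *v x p)))
    \<le> a * (\<Sum>i\<in>I. ln (x i \<bullet> (P *v x i))) - real n / 2 * ln (det P))"
    using log_det_bound by (elim exE conjE) (rule that)
  define B where "B = 1 / b powr \<beta>"
  have B: "0 < B" using b by (simp add: B_def)
  \<comment> \<open>The function \<open>B / 2 * exp (\<beta> * \<tau>) - \<kappa> * \<tau>\<close>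
    is minimal at \<open>\<beta> * \<tau> = s\<close>, with value \<open>- M\<close>; the tangent of
    exp at s proves the bound.\<close>
  define s where "s = ln (2 * \<kappa> / (B * \<beta>))"
  define M where "M = - \<kappa> / \<beta> * (1 - s)"
  have M: "- M \<le> B / 2 * exp (\<beta> * \<tau>) - \<kappa> * \<tau>" for \<tau>
  proof -
    have es: "exp s = 2 * \<kappa> / (B * \<beta>)"
      using B \<beta> kappa_pos by (simp add: s_def)
    have "B / 2 * (exp s * (1 + (\<beta> * \<tau> - s))) \<le> B / 2 * (exp s * exp (\<beta> * \<tau> - s))"
      using B exp_ge_add_one_self[of "\<beta> * \<tau> - s"] by (intro mult_left_mono) auto
    also have "exp s * exp (\<beta> * \<tau> - s) = exp (\<beta> * \<tau>)" by (simp add: mult_exp_exp)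
    also have "B / 2 * (exp s * (1 + (\<beta> * \<tau> - s))) = \<kappa> * \<tau> - M"
      using B \<beta> unfolding es M_def by (simp add: field_simps)
    finally show ?thesis by simp
  qed
  define N where "N = max 0 (K + C + M)"
  define lo where "lo = exp (- (K + C) / \<kappa> - N / \<delta>)"
  define hi where "hi = (2 * N / B) powr (1 / \<beta>)"
  have "lo \<le> x i \<bullet> (P *v x i) \<and> x i \<bullet> (P *v x i) \<le> hi"
    if P: "pos_def_mat P" and K: "\<Psi> P \<le> K" and i: "i \<in> I" for P i
  proof -
    define t where "t i = x i \<bullet> (P *v x i)" for i
    have t_pos: "0 < t i" if "i \<in> I" for i
      using form_pos[OF P that] by (simp add: t_def)
    obtain p q where pq: "p \<in> I" "q \<in> I" "\<And>i. i \<in> I \<Longrightarrow> t p \<le> t i"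
      and le: "- C - \<kappa> * ln (t q) + \<delta> * (ln (t q) - ln (t p))
        \<le> a * (\<Sum>i\<in>I. ln (t i)) - real n / 2 * ln (det P)"
      using bound P unfolding t_def by blast
    define Q where "Q = (\<Sum>i\<in>I. t i powr \<beta>)"
    have tQ: "t i powr \<beta> \<le> Q" if "i \<in> I" for i
      unfolding Q_def using finite_I that by (intro member_le_sum) auto
    have "t q powr \<beta> = exp (\<beta> * ln (t q))" using t_pos[OF pq(2)] by (simp add: powr_def)
    then have eQ: "exp (\<beta> * ln (t q)) \<le> Q" using tQ[OF pq(2)] by simp
    have total: "- C - \<kappa> * ln (t q) + \<delta> * (ln (t q) - ln (t p)) + B * Q \<le> K"
      using le K by (simp add: \<Psi>_def t_def[symmetric] Q_def[symmetric] B_def)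
    have pq_le: "0 \<le> \<delta> * (ln (t q) - ln (t p))"
      using pq t_pos \<delta> by (intro mult_nonneg_nonneg) auto
    have Q0: "0 \<le> B * Q" using B by (simp add: Q_def sum_nonneg)
    have "B / 2 * exp (\<beta> * ln (t q)) \<le> B / 2 * Q"
      using eQ B by (intro mult_left_mono) auto
    then have half: "- M \<le> B / 2 * Q - \<kappa> * ln (t q)"
      using M[of "ln (t q)"] by linarith
    have KN: "K + C + M \<le> N" and BQ: "B * Q = 2 * (B / 2 * Q)" by (simp_all add: N_def)
    have "B / 2 * Q \<le> N"
      using total half pq_le KN BQ by linarith
    then have "Q \<le> 2 * N / B" using B by (simp add: field_simps)
    then have "t i powr \<beta> \<le> 2 * N / B" using tQ[OF i] by linarith
    then have "(t i powr \<beta>) powr (1 / \<beta>) \<le> hi"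
      unfolding hi_def using \<beta> by (intro powr_mono2) auto
    then have hi: "t i \<le> hi"
      using t_pos[OF i] \<beta> by (simp add: powr_powr)
    have "\<delta> * (ln (t q) - ln (t p)) \<le> N"
      using total half Q0 KN BQ by linarith
    then have 1: "ln (t q) - ln (t p) \<le> N / \<delta>"
      using \<delta> by (simp add: field_simps)
    have "- (K + C) \<le> \<kappa> * ln (t q)" using total pq_le Q0 by linarith
    then have "- (K + C) / \<kappa> \<le> ln (t q)" using kappa_pos by (simp add: field_simps)
    with 1 have "- (K + C) / \<kappa> - N / \<delta> \<le> ln (t p)" by linarith
    then have "lo \<le> t p"
      unfolding lo_def using t_pos[OF pq(1)] by (simp add: ln_ge_iff)
    then have "lo \<le> t i" using pq(3)[OF i] by linarith
    then show ?thesis using hi by (simp add: t_def)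
  qed
  then show ?thesis using that[of lo hi] by (simp add: lo_def)
qed

end

section \<open>Existence of the fixed point\<close>

text \<open>Cauchy-Schwarz for the pair P v, v shows that v.(P v) = 0 forces P v = 0. Strict
  positivity can thus be replaced by semidefiniteness and a lower bound on the determinant, which
  are closed conditions.\<close>

lemma psd_nonsingular_pos_def:
  fixes P :: "real^'d^'d"
  assumes sym: "transpose P = P" and psd: "\<And>v. 0 \<le> v \<bullet> (P *v v)" and "det P \<noteq> 0"
  shows "pos_def_mat P"
  unfolding pos_def_mat_def
proof (intro conjI allI impI sym)
  fix v :: "real^'d" assume "v \<noteq> 0"
  then have "P *v v \<noteq> 0"
    using \<open>det P \<noteq> 0\<close> invertible_det_nz[of P] invertible_left_inverse[of P]
      matrix_left_invertible_ker[of P] by blast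
  then have "0 < ((P *v v) \<bullet> (P *v v))\<^sup>2" by simp
  also have "\<dots> \<le> ((P *v v) \<bullet> (P *v (P *v v))) * (v \<bullet> (P *v v))"
    by (rule psd_Cauchy_Schwarz[OF sym psd])
  finally show "0 < v \<bullet> (P *v v)"
    using psd[of v] by (cases "v \<bullet> (P *v v) = 0") auto
qed

text \<open>The vectors at which the forms are uniformly bounded make up a subspace; containing X,
  it is everything. Polarisation then bounds the entries.\<close>

lemma bounded_forms_imp_bounded:
  fixes \<K> :: "(real^'d^'d) set" and X :: "(real^'d) set"
  assumes sym: "\<And>P. P \<in> \<K> \<Longrightarrow> transpose P = P"
    and psd: "\<And>P v. P \<in> \<K> \<Longrightarrow> 0 \<le> v \<bullet> (P *v v)"
    and span: "span X = UNIV"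
    and bound: "\<And>P v. P \<in> \<K> \<Longrightarrow> v \<in> X \<Longrightarrow> v \<bullet> (P *v v) \<le> c"
  shows "bounded \<K>"
proof -
  define W where "W = {v. \<exists>c. \<forall>P\<in>\<K>. v \<bullet> (P *v v) \<le> c}"
  have "subspace W"
    unfolding subspace_def
  proof (intro conjI ballI allI)
    show "0 \<in> W" by (auto simp: W_def)
    fix u v assume "u \<in> W" "v \<in> W"
    then obtain c1 c2 where c: "\<forall>P\<in>\<K>. u \<bullet> (P *v u) \<le> c1" "\<forall>P\<in>\<K>. v \<bullet> (P *v v) \<le> c2"
      by (auto simp: W_def)
    \<comment> \<open>Parallelogram law, dropping the nonnegative form at u - v.\<close>
    have "(u + v) \<bullet> (P *v (u + v)) \<le> 2 * c1 + 2 * c2" if "P \<in> \<K>" for P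
      using psd[OF that, of "u - v"] c that
      by (force simp: matrix_vector_right_distrib matrix_vector_mult_diff_distrib inner_add_left
          inner_add_right inner_diff_left inner_diff_right)
    then show "u + v \<in> W" by (auto simp: W_def)
  next
    fix r :: real and v assume "v \<in> W"
    then obtain c where c: "\<forall>P\<in>\<K>. v \<bullet> (P *v v) \<le> c" by (auto simp: W_def)
    have "(r *\<^sub>R v) \<bullet> (P *v (r *\<^sub>R v)) \<le> r\<^sup>2 * c" if "P \<in> \<K>" for P
      using mult_left_mono[OF bspec[OF c that], of "r\<^sup>2"]
      by (simp add: matrix_vector_mult_scaleR power2_eq_square mult.assoc)
    then show "r *\<^sub>R v \<in> W" by (auto simp: W_def)
  qed
  moreover have "X \<subseteq> W" using bound by (auto simp: W_def)
  ultimately have "span X \<subseteq> W" by (rule span_minimal[rotated])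
  then have "\<forall>v. \<exists>c. \<forall>P\<in>\<K>. v \<bullet> (P *v v) \<le> c" using span by (auto simp: W_def)
  then obtain C where C: "\<And>v P. P \<in> \<K> \<Longrightarrow> v \<bullet> (P *v v) \<le> C v" by metis
  let ?e = "\<lambda>i. axis i (1::real) :: real^'d"
  define D where "D i j = C (?e i + ?e j) + C (?e i) + C (?e j)" for i j
  have entry: "\<bar>P $ i $ j\<bar> \<le> D i j" if P: "P \<in> \<K>" for P i j
  proof -
    have "P $ i $ j = ?e i \<bullet> (P *v ?e j)"
      by (simp add: matrix_vector_mul_component inner_axis inner_axis' row_def)
    then have "2 * (P $ i $ j) = (?e i + ?e j) \<bullet> (P *v (?e i + ?e j))
        - ?e i \<bullet> (P *v ?e i) - ?e j \<bullet> (P *v ?e j)"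
      using symmetric_inner_commute[OF sym[OF P], of "?e i" "?e j"]
      by (simp add: matrix_vector_right_distrib inner_add_left inner_add_right)
    then show ?thesis
      using C[OF P, of "?e i + ?e j"] C[OF P, of "?e i"] C[OF P, of "?e j"]
        psd[OF P, of "?e i + ?e j"] psd[OF P, of "?e i"] psd[OF P, of "?e j"]
      unfolding D_def by linarith
  qed
  have "norm P \<le> (\<Sum>i\<in>UNIV. \<Sum>j\<in>UNIV. D i j)" if P: "P \<in> \<K>" for P
  proof -
    have "norm P \<le> (\<Sum>i\<in>UNIV. norm (P $ i))"
      unfolding norm_vec_def[of P] by (rule L2_set_le_sum) simp
    also have "\<dots> \<le> (\<Sum>i\<in>UNIV. \<Sum>j\<in>UNIV. \<bar>P $ i $ j\<bar>)"
      by (intro sum_mono norm_le_l1_cart)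
    also have "\<dots> \<le> (\<Sum>i\<in>UNIV. \<Sum>j\<in>UNIV. D i j)"
      by (intro sum_mono entry P)
    finally show ?thesis .
  qed
  then show ?thesis by (auto simp: bounded_iff)
qed

text \<open>The case k = l is a diagonal scaling and is included on purpose: the d^2 directions
  together give every entry of the stationarity equation.\<close>

definition elementary :: "'d \<Rightarrow> 'd \<Rightarrow> real \<Rightarrow> real^'d^'d" where
  "elementary k l s = (\<chi> i j. (if i = j then 1 else 0) + (if i = k \<and> j = l then s else 0))"

lemma elementary_mult_vector:
  "elementary k l s *v v = v + (s * v $ l) *\<^sub>R axis k 1"
proof -
  have "(elementary k l s *v v) $ i = (v + (s * v $ l) *\<^sub>R axis k 1) $ i" for i
  proof -
    have "(elementary k l s *v v) $ i
        = (\<Sum>j\<in>UNIV. (if i = j then v $ j else 0) + (if j = l then (if i = k then s * v $ j else 0) else 0))"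
      unfolding elementary_def matrix_vector_mult_def by (auto intro!: sum.cong simp: ring_distribs)
    then show ?thesis by (simp add: sum.distrib axis_def)
  qed
  then show ?thesis by (simp add: vec_eq_iff)
qed

lemma det_elementary: "det (elementary k l s) = (if k = l then 1 + s else 1)"
proof (cases "k = l")
  case True
  have "det (elementary k l s) = (\<Prod>i\<in>UNIV. elementary k l s $ i $ i)"
    by (rule det_diagonal) (auto simp: elementary_def True)
  also have "\<dots> = (\<Prod>i\<in>UNIV. if i = k then 1 + s else 1)"
    by (intro prod.cong) (auto simp: elementary_def True)
  finally show ?thesis using True by simp
next
  case False
  have "elementary k l s
      = (\<chi> i. if i = k then row k (mat 1) + s *s row l (mat 1) else row i (mat 1))"
    by (auto simp: elementary_def vec_eq_iff row_def mat_def)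
  then show ?thesis
    using det_row_operation[OF False, of "mat 1" s] False by simp
qed

section \<open>The minimiser and its stationarity equation\<close>

context kotz_estimation
begin

lemma minimizer_exists:
  obtains P where "pos_def_mat P" and "\<And>Q. pos_def_mat Q \<Longrightarrow> \<Psi> P \<le> \<Psi> Q"
proof -
  define K where "K = \<Psi> (mat 1)"
  obtain lo hi where lo: "0 < lo" and bounds: "\<And>P i. pos_def_mat P \<Longrightarrow> \<Psi> P \<le> K \<Longrightarrow> i \<in> I \<Longrightarrow>
    lo \<le> x i \<bullet> (P *v x i) \<and> x i \<bullet> (P *v x i) \<le> hi"
    using sublevel_bounds[of K] by blast
  \<comment> \<open>Obtained from \<open>\<Psi> P \<le> K\<close> by dropping the power term,
    bounding each form below by \<open>lo\<close> and solving for \<open>det P\<close>.\<close>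
  define \<epsilon> where "\<epsilon> = exp (2 / real n * (a * (real (card I) * ln lo) - K))"
  define \<K> :: "(real^'d^'d) set" where "\<K> = {P. (\<forall>i j. P $ i $ j = P $ j $ i) \<and> (\<forall>v. 0 \<le> v \<bullet> (P *v v))
      \<and> \<epsilon> \<le> det P \<and> (\<forall>i\<in>I. x i \<bullet> (P *v x i) \<le> hi)}"
  have sublevel: "P \<in> \<K>" if P: "pos_def_mat P" and PK: "\<Psi> P \<le> K" for P
  proof -
    have "P $ i $ j = P $ j $ i" for i j
      using arg_cong[OF pos_def_matD(1)[OF P], of "\<lambda>A. A $ j $ i"] by (simp add: transpose_def)
    moreover have "\<epsilon> \<le> det P"
    proof -
      have "real (card I) * ln lo \<le> (\<Sum>i\<in>I. ln (x i \<bullet> (P *v x i)))"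
        using bounds[OF P PK] lo by (intro sum_bounded_below ln_mono) auto
      then have "a * (real (card I) * ln lo) \<le> a * (\<Sum>i\<in>I. ln (x i \<bullet> (P *v x i)))"
        using a_nonneg by (rule mult_left_mono)
      moreover have "0 \<le> (\<Sum>i\<in>I. (x i \<bullet> (P *v x i)) powr \<beta>) / b powr \<beta>"
        by (intro divide_nonneg_nonneg sum_nonneg) auto
      ultimately have "a * (real (card I) * ln lo) - K \<le> real n / 2 * ln (det P)"
        using PK unfolding \<Psi>_def by linarith
      then have "2 / real n * (a * (real (card I) * ln lo) - K) \<le> ln (det P)"
        using n_pos by (simp add: field_simps)
      then show ?thesis
        unfolding \<epsilon>_def using pos_def_mat_det_pos[OF P] by (simp add: ln_ge_iff)
    qed
    ultimately show ?thesis
      using pos_def_matD(3)[OF P] bounds[OF P PK] by (simp add: \<K>_def)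
  qed
  have sym: "transpose P = P" if "P \<in> \<K>" for P
    using that by (simp add: \<K>_def transpose_def vec_eq_iff)
  have det_pos: "0 < det P" if "P \<in> \<K>" for P
    using that less_le_trans[of 0 \<epsilon> "det P"] by (simp add: \<K>_def \<epsilon>_def)
  have pd: "pos_def_mat P" if "P \<in> \<K>" for P
    using psd_nonsingular_pos_def[OF sym[OF that]] det_pos[OF that] that by (simp add: \<K>_def)
  have "closed \<K>"
    unfolding \<K>_def Ball_def
    by (intro closed_Collect_conj closed_Collect_all closed_Collect_imp closed_Collect_eq
        closed_Collect_le continuous_intros continuous_on_id open_Collect_const)
  moreover have "bounded \<K>"
  proof (rule bounded_forms_imp_bounded[OF sym _ span_x])
    fix P v assume "P \<in> \<K>" "v \<in> x ` {..<n}"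
    \<comment> \<open>The 0 covers zero observations, which lie outside \<open>I\<close>.\<close>
    then show "v \<bullet> (P *v v) \<le> max 0 hi"
      by (cases "v = 0") (auto simp: \<K>_def I_def le_max_iff_disj)
  qed (simp_all add: \<K>_def)
  ultimately have "compact \<K>" by (simp add: compact_eq_bounded_closed)
  moreover have "mat 1 \<in> \<K>" using sublevel[OF pos_def_mat_1] by (simp add: K_def)
  moreover have "continuous_on \<K> \<Psi>"
  proof -
    have "x i \<bullet> (P *v x i) \<noteq> 0" if "P \<in> \<K>" "i \<in> I" for P i
      using form_pos[OF pd] that by fastforce
    moreover have "det P \<noteq> 0" if "P \<in> \<K>" for P
      using det_pos[OF that] by simp
    ultimately show ?thesis
      unfolding \<Psi>_def[abs_def] using b by (intro continuous_intros continuous_on_id) auto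
  qed
  ultimately obtain P where P: "P \<in> \<K>" "\<And>Q. Q \<in> \<K> \<Longrightarrow> \<Psi> P \<le> \<Psi> Q"
    using continuous_attains_inf[of \<K> \<Psi>] by blast
  have "\<Psi> P \<le> \<Psi> Q" if "pos_def_mat Q" for Q
  proof (cases "\<Psi> Q \<le> K")
    case True
    then show ?thesis using P(2) sublevel that by blast
  next
    case False
    then show ?thesis using P(2)[OF \<open>mat 1 \<in> \<K>\<close>] by (simp add: K_def)
  qed
  then show ?thesis using that pd[OF P(1)] by blast
qed

text \<open>Varying P along congruences by elementary matrices keeps it positive definite and changes
  the determinant explicitly, so that only one-variable calculus is needed.\<close>

lemma minimizer_stationary:
  assumes P: "pos_def_mat P" and min: "\<And>Q. pos_def_mat Q \<Longrightarrow> \<Psi> P \<le> \<Psi> Q"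
  shows "2 / real n * (\<Sum>i<n. h (x i \<bullet> (P *v x i)) * ((P *v x i) $ k * x i $ l)) = (if k = l then 1 else 0)"
proof -
  define t where "t i = x i \<bullet> (P *v x i)" for i
  \<comment> \<open>First and second order coefficients of the i-th form along the path
    \<open>Q s\<close>; \<open>e\<close> is the slope of the determinant of the elementary
    matrix.\<close>
  define u where "u i = 2 * (x i $ l * (P *v x i) $ k)" for i
  define w where "w i = (x i $ l)\<^sup>2 * (axis k 1 \<bullet> (P *v axis k 1))" for i
  define e :: real where "e = (if k = l then 1 else 0)"
  define Q where "Q s = transpose (elementary k l s) ** P ** elementary k l s" for s
  have t_pos: "0 < t i" if "i \<in> I" for i
    using form_pos[OF P that] by (simp add: t_def)
  have det_pos: "0 < det P" by (rule pos_def_mat_det_pos[OF P])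
  have Q_form: "x i \<bullet> (Q s *v x i) = t i + s * u i + s\<^sup>2 * w i" for i s
  proof -
    have "x i \<bullet> (Q s *v x i) = (elementary k l s *v x i) \<bullet> (P *v (elementary k l s *v x i))"
      unfolding Q_def
      by (metis (no_types, lifting) dot_lmul_matrix inner_commute matrix_vector_mul_assoc
          transpose_matrix_vector)
    also have "\<dots> = t i + s * u i + s\<^sup>2 * w i"
      using symmetric_inner_commute[OF pos_def_matD(1)[OF P], of "x i" "axis k 1"]
      by (simp add: elementary_mult_vector t_def u_def w_def matrix_vector_right_distrib
          matrix_vector_mult_scaleR inner_add_left inner_add_right inner_axis'
          power2_eq_square algebra_simps)
    finally show ?thesis .
  qed
  have ln_det_Q: "ln (det (Q s)) = ln (det P) + 2 * ln (1 + s * e)" and pd_Q: "pos_def_mat (Q s)"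
    if "\<bar>s\<bar> < 1" for s
  proof -
    have d: "det (elementary k l s) = 1 + s * e" and pos: "0 < 1 + s * e"
      using that by (auto simp: det_elementary e_def)
    show "pos_def_mat (Q s)"
      unfolding Q_def using pos by (intro pos_def_mat_congruence[OF P]) (simp add: d)
    have "det (Q s) = det P * ((1 + s * e) * (1 + s * e))"
      by (simp add: Q_def det_mul d)
    then show "ln (det (Q s)) = ln (det P) + 2 * ln (1 + s * e)"
      using pos det_pos ln_mult_pos[of "det P" "(1 + s * e) * (1 + s * e)"]
        ln_mult_pos[of "1 + s * e" "1 + s * e"] by simp
  qed
  define \<phi> where "\<phi> s = a * (\<Sum>i\<in>I. ln (t i + s * u i + s\<^sup>2 * w i))
      - real n / 2 * (ln (det P) + 2 * ln (1 + s * e))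
      + (\<Sum>i\<in>I. (t i + s * u i + s\<^sup>2 * w i) powr \<beta>) / b powr \<beta>" for s
  have \<phi>_eq: "\<phi> s = \<Psi> (Q s)" if "\<bar>s\<bar> < 1" for s
    by (simp add: \<phi>_def \<Psi>_def Q_form ln_det_Q[OF that])
  have "\<phi> 0 \<le> \<phi> s" if "\<bar>0 - s\<bar> < 1" for s
  proof -
    have "\<phi> 0 = \<Psi> P" by (simp add: \<phi>_def \<Psi>_def t_def)
    then show ?thesis using min[OF pd_Q, of s] \<phi>_eq[of s] that by simp
  qed
  moreover have "(\<phi> has_real_derivative
      (a * (\<Sum>i\<in>I. u i / t i) - real n * e + (\<Sum>i\<in>I. \<beta> * t i powr (\<beta> - 1) * u i) / b powr \<beta>)) (at 0)"
  proof -
    have q: "((\<lambda>s. t i + s * u i + s\<^sup>2 * w i) has_real_derivative u i) (at 0)" for i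
      by (auto intro!: derivative_eq_intros)
    have L: "((\<lambda>s. ln (t i + s * u i + s\<^sup>2 * w i)) has_real_derivative u i / t i) (at 0)"
      if "i \<in> I" for i
      using q[of i] t_pos[OF that] by (auto intro!: derivative_eq_intros)
    have R: "((\<lambda>s. (t i + s * u i + s\<^sup>2 * w i) powr \<beta>) has_real_derivative
        \<beta> * t i powr (\<beta> - 1) * u i) (at 0)" if "i \<in> I" for i
      using DERIV_fun_powr[OF q[of i], of \<beta>] t_pos[OF that] by simp
    have E: "((\<lambda>s. real n / 2 * (ln (det P) + 2 * ln (1 + s * e))) has_real_derivative real n * e) (at 0)"
      by (auto intro!: derivative_eq_intros)
    show ?thesis
      unfolding \<phi>_def
      by (intro DERIV_add DERIV_diff DERIV_cmult DERIV_cdivide DERIV_sum L R E)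
  qed
  ultimately have D0: "a * (\<Sum>i\<in>I. u i / t i) - real n * e
      + (\<Sum>i\<in>I. \<beta> * t i powr (\<beta> - 1) * u i) / b powr \<beta> = 0"
    by (intro DERIV_local_min[of \<phi> _ 0 1]) auto
  have "(\<Sum>i\<in>I. h (t i) * u i) = a * (\<Sum>i\<in>I. u i / t i)
      + (\<Sum>i\<in>I. \<beta> * t i powr (\<beta> - 1) * u i) / b powr \<beta>"
    unfolding sum_distrib_left sum_divide_distrib sum.distrib[symmetric]
    by (intro sum.cong) (auto simp: h_def kotz_h_def a_def ring_distribs)
  then have "(\<Sum>i\<in>I. h (t i) * u i) = real n * e" using D0 by simp
  moreover have "(\<Sum>i<n. h (t i) * u i) = (\<Sum>i\<in>I. h (t i) * u i)"
    by (intro sum.mono_neutral_right) (auto simp: I_def u_def)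
  moreover have "(\<Sum>i<n. h (t i) * u i) = 2 * (\<Sum>i<n. h (t i) * ((P *v x i) $ k * x i $ l))"
    by (simp add: u_def sum_distrib_left mult_ac)
  ultimately have "2 * (\<Sum>i<n. h (t i) * ((P *v x i) $ k * x i $ l)) = real n * e" by simp
  then show ?thesis using n_pos by (simp add: t_def e_def field_simps)
qed

text \<open>The stationarity equations are the entries of P f(P^-1) = 1, so f(P^-1) is the inverse
  of P.\<close>

lemma fixed_point_exists:
  obtains S where "pos_def_mat S" "f S = S"
proof -
  obtain P where P: "pos_def_mat P" and min: "\<And>Q. pos_def_mat Q \<Longrightarrow> \<Psi> P \<le> \<Psi> Q"
    using minimizer_exists by blast
  have inv: "matrix_inv (matrix_inv P) = P"
    using matrix_inv_unique(1)[OF matrix_inv_mult(1)[OF pos_def_mat_invertible[OF P]]] .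
  have "P ** f (matrix_inv P) = mat 1"
  proof -
    have "(P ** f (matrix_inv P)) $ k $ l = (mat 1 :: real^'d^'d) $ k $ l" for k l
    proof -
      have "(P ** f (matrix_inv P)) $ k $ l
          = (\<Sum>m\<in>UNIV. \<Sum>i<n. 2 / real n * (h (x i \<bullet> (P *v x i)) * (P $ k $ m * x i $ m * x i $ l)))"
        unfolding matrix_matrix_mult_def kotz_map_def inv
        by (simp add: outer_def sum_distrib_left h_def mult_ac)
      also have "\<dots> = 2 / real n * (\<Sum>i<n. h (x i \<bullet> (P *v x i)) * ((P *v x i) $ k * x i $ l))"
        by (subst sum.swap)
           (simp add: matrix_vector_mult_def sum_distrib_left sum_distrib_right mult_ac)
      also have "\<dots> = (mat 1 :: real^'d^'d) $ k $ l"
        using minimizer_stationary[OF P min] by (simp add: mat_def)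
      finally show ?thesis .
    qed
    then show ?thesis by (simp add: vec_eq_iff)
  qed
  then have "f (matrix_inv P) = matrix_inv P"
    using matrix_inv_unique(2) by metis
  then show ?thesis using that pos_def_mat_inv[OF P] by blast
qed

end

theorem theorem47:
  fixes x :: "nat \<Rightarrow> real^'d" and n :: nat and \<alpha> \<beta> b :: real
  assumes "b > 0" and "0 < \<beta>" and "\<beta> < 2" and "0 < \<alpha>" and "\<alpha> \<le> real CARD('d) / 2"
    and "span (x ` {..<n}) = UNIV"
    and "\<And>L. subspace L \<Longrightarrow> 1 \<le> dim L \<Longrightarrow> dim L < CARD('d) \<Longrightarrow>
           (real CARD('d) - 2 * \<alpha>) * real (card {i. i < n \<and> x i \<in> L}) < real n * real (dim L)"
  shows "\<exists>S\<^sub>f. pos_def_mat S\<^sub>f \<and> kotz_map \<alpha> \<beta> b n x S\<^sub>f = S\<^sub>f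
           \<and> (\<forall>S. pos_def_mat S \<and> kotz_map \<alpha> \<beta> b n x S = S \<longrightarrow> S = S\<^sub>f)
           \<and> (\<forall>S\<^sub>0. pos_def_mat S\<^sub>0 \<longrightarrow> (\<lambda>k. (kotz_map \<alpha> \<beta> b n x ^^ k) S\<^sub>0) \<longlonglongrightarrow> S\<^sub>f)"
proof -
  interpret kotz_estimation x n \<alpha> \<beta> b
    using assms by unfold_locales
  obtain R where R: "pos_def_mat R" "f R = R"
    by (rule fixed_point_exists)
  then show ?thesis
    using fixed_point_unique[OF R] iterates_converge_to_fixed_point[OF R] by blast
qed

end
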